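(* Let $\mathfrak X$ be a real separable M-type 2 Banach space and let $F=\{F_t: t\in[0,T]\}\in\mathscr M$ be a non-degenerate convex set-valued stochastic process. Then the integral process $\{I_t(F): t\in(0,T]\}$, $I_t(F)=\int_0^{t+}\int_Z F_s(z)\,\tilde N(ds\,dz)$, is not a set-valued martingale with respect to $\{\mathcal F_t\}$.
   Context: Setting. $(\Omega,\mathcal F,\{\mathcal F_t\}_{t\ge0},P)$ is a complete filtered probability space satisfying the usual conditions. $(\mathfrak X,\|\cdot\|)$ is a real separable Banach space, and $\mathbf K(\mathfrak X)$ is the family of nonempty closed subsets of $\mathfrak X$. $\mathfrak X$ is of M-type 2 if there is a constant $C_{\mathfrak X}>0$ such that $\sup_k E\|M_k\|^2\le C_{\mathfrak X}\sum_k E\|M_k-M_{k-1}\|^2$ for every $\mathfrak X$-valued martingale $\{M_k\}$. $Z$ is a separable Banach space with Borel $\sigma$-algebra $\mathcal B(Z)$, $\nu$ is a finite measure on $(Z,\mathcal B(Z))$ with $\nu(Z)>0$, and $T>0$. $\mathbf p$ is an $\{\mathcal F_t\}$-adapted stationary Poisson point process on $Z$ with characteristic measure $\nu$; $N(dt\,dz)$ is its Poisson random (counting) measure on $[0,T]\times Z$, with intensity $dt\,\nu(dz)$, and $\tilde N(dt\,dz)=N(dt\,dz)-dt\,\nu(dz)$ is the compensated measure, $\tilde N((0,t],U)$ being an $\{\mathcal F_t\}$-martingale for each $U\in\mathcal B(Z)$. Set-valued random variables. $F:\Omega\to\mathbf K(\mathfrak X)$ is measurable if $\{\omega:F(\omega)\cap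 O\ne\emptyset\}\in\mathcal F$ for every open $O\subset\mathfrak X$; measurability with respect to other $\sigma$-algebras is defined likewise. $\|A\|_{\mathbf K}=\sup_{a\in A}\|a\|$. For a sub-$\sigma$-algebra $\mathcal G$ and $p\ge1$, $S^p_F(\mathcal G)$ is the set of $f\in L^p(\Omega,\mathcal G,P;\mathfrak X)$ with $f(\omega)\in F(\omega)$ a.s. $F$ is integrably bounded if $\|F\|_{\mathbf K}\in L^1(\Omega;\mathbb R)$. The conditional expectation $E[F|\mathcal G]$ is the $\mathcal G$-measurable set-valued random variable determined by $S^1_{E[F|\mathcal G]}(\mathcal G)=\mathrm{cl}\{E[f|\mathcal G]: f\in S^1_F(\mathcal F)\}$ (closure in $L^1$). Integrands. $\mathscr S$ is the smallest $\sigma$-algebra on $[0,T]\times Z\times\Omega$ making measurable all $g:[0,T]\times Z\times\Omega\to\mathfrak X$ such that $(z,\omega)\mapsto g(t,z,\omega)$ is $\mathcal B(Z)\otimes\mathcal F_t$-measurable for each $t$ and $t\mapsto g(t,z,\omega)$ is left continuous for each $(z,\omega)$. $\mathscr L$ is the set of $\mathscr S$-measurable ($\mathscr S$-predictable) $f:[0,T]\times Z\times\Omega\to\mathfrak X$ with $E\int_0^T\int_Z\|f_t(z)\|^2\nu(dz)dt<\infty$. $\mathscr M$ is the set of $\mathscr S$-measurable $F:[0,T]\times Z\times\Omega\to\mathbf K(\mathfrak X)$ with $E\int_0^T\int_Z\|F_t(z)\|^2_{\mathbf K}\,dt\,\nu(dz)<\infty$. Here $f_t(z)=f(t,z,\omega)$,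 $F_t(z)=F(t,z,\omega)$. $S(F)=\{f\in\mathscr L: f(t,z,\omega)\in F(t,z,\omega)\text{ for a.e. }(t,z,\omega)\}$. Integrals. For $f\in\mathscr L$, $\int_0^{t+}\int_Z f_s(z)N(ds\,dz)$ is the integral over $(0,t]\times Z$ (a.s. a finite sum), and $\int_0^{t+}\int_Z f_s(z)\tilde N(ds\,dz)=\int_0^{t+}\int_Z f_s(z)N(ds\,dz)-\int_0^t\int_Z f_s(z)\,ds\,\nu(dz)$. For $F\in\mathscr M$, put $\tilde\Gamma_t=\{\int_0^{t+}\int_Z f_s(z)\tilde N(ds\,dz): f\in S(F)\}$. The decomposable hull of a set $\Gamma$ of random variables with respect to $\mathcal F_t$ is $de\,\Gamma=\{\sum_{i=1}^m\chi_{A_i}g_i: m\ge 1,\ \{A_i\}\text{ a finite }\mathcal F_t\text{-measurable partition of }\Omega,\ g_i\in\Gamma\}$; $\overline{de}\,\Gamma$ is its closure in $L^1(\Omega;\mathfrak X)$. $I_t(F)$ is the $\mathcal F_t$-measurable $\mathbf K(\mathfrak X)$-valued random variable (unique a.s.) with $S^1_{I_t(F)}(\mathcal F_t)=\overline{de}\,\tilde\Gamma_t$. Terminology. A convex set is non-degenerate if it has infinitely many elements; a process $F$ is non-degenerate convex if for each $t$, $F(t,z,\omega)$ is a non-degenerate closed convex set for a.e. $(z,\omega)$. An integrably bounded, convex-valued, $\mathcal F_t$-adapted set-valued process $\{F_t\}$ is a set-valued martingale if for all $s\le t$ in the index set $E[F_t|\mathcal F_s]=F_s$, in the sense that $S^1_{E[F_t|\mathcal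 F_s]}(\mathcal F_s)=S^1_{F_s}(\mathcal F_s)$. *)

theory Defs
  imports "HOL-Probability.Probability"
begin

section \<open>Filtered probability spaces, conditional expectation, martingales\<close>

locale usual_filtered_prob_space = prob_space M + complete_measure M
  for M :: "'w measure" and \<F> :: "real \<Rightarrow> 'w measure" +
  assumes subalg: "t \<ge> 0 \<Longrightarrow> subalgebra M (\<F> t)"
    and mono: "0 \<le> s \<Longrightarrow> s \<le> t \<Longrightarrow> sets (\<F> s) \<subseteq> sets (\<F> t)"
    and null: "null_sets M \<subseteq> sets (\<F> 0)"
    and right_cont: "t \<ge> 0 \<Longrightarrow> sets (\<F> t) = (\<Inter>u\<in>{t<..}. sets (\<F> u))"

text \<open>Elements of \<open>L\<^sup>1\<close> are represented by functions; all sets of functions below are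
  closed under almost sure modification within the \<open>\<sigma>\<close>-algebra concerned.\<close>

definition L1 :: "'w measure \<Rightarrow> 'w measure \<Rightarrow> ('w \<Rightarrow> 'x::{banach, second_countable_topology}) set" where
  "L1 M G = {f. f \<in> borel_measurable G \<and> integrable M f}"

definition L1_closure ::
  "'w measure \<Rightarrow> 'w measure \<Rightarrow> ('w \<Rightarrow> 'x::{banach, second_countable_topology}) set \<Rightarrow> ('w \<Rightarrow> 'x) set" where
  "L1_closure M G \<Gamma> =
     {g \<in> L1 M G. \<forall>e>0. \<exists>f\<in>\<Gamma> \<inter> L1 M G. (\<integral>\<omega>. norm (f \<omega> - g \<omega>) \<partial>M) < e}"

text \<open>\<open>h\<close> is a version of \<open>E[f | G]\<close>. The library's conditional expectation is only real-valued.\<close>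

definition has_cond_exp ::
  "'w measure \<Rightarrow> 'w measure \<Rightarrow> ('w \<Rightarrow> 'x::{banach, second_countable_topology}) \<Rightarrow> ('w \<Rightarrow> 'x) \<Rightarrow> bool" where
  "has_cond_exp M G f h \<longleftrightarrow> integrable M f \<and> h \<in> L1 M G \<and>
     (\<forall>A\<in>sets G. set_lebesgue_integral M A h = set_lebesgue_integral M A f)"

text \<open>Adaptedness and integrability are the case \<open>s = t\<close> of the last conjunct.\<close>

definition martingale_on ::
  "'w measure \<Rightarrow> ('i::linorder \<Rightarrow> 'w measure) \<Rightarrow> 'i set \<Rightarrow>
   ('i \<Rightarrow> 'w \<Rightarrow> 'x::{banach, second_countable_topology}) \<Rightarrow> bool" where
  "martingale_on M G J X \<longleftrightarrow>
     (\<forall>t\<in>J. subalgebra M (G t)) \<and>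
     (\<forall>s\<in>J. \<forall>t\<in>J. s \<le> t \<longrightarrow> sets (G s) \<subseteq> sets (G t)) \<and>
     (\<forall>s\<in>J. \<forall>t\<in>J. s \<le> t \<longrightarrow> has_cond_exp M (G s) (X t) (X s))"

text \<open>M-type 2, with the usual convention \<open>M\<^bsub>-1\<^esub> = 0\<close> (otherwise nonzero constant martingales
  would violate the inequality). The quantifier over all probability spaces is rendered
  by the probability measures on the path space type \<open>nat \<Rightarrow> 'x\<close>: nothing is lost, since every
  martingale in discrete time has the same law as the coordinate process on its path space.\<close>

definition M_type_2 :: "'x::{banach, second_countable_topology} itself \<Rightarrow> bool" where
  "M_type_2 X \<longleftrightarrow> (\<exists>C::real. C > 0 \<and>
     (\<forall>(P :: (nat \<Rightarrow> 'x) measure) (G :: nat \<Rightarrow> (nat \<Rightarrow> 'x) measure) (m :: nat \<Rightarrow> (nat \<Rightarrow> 'x) \<Rightarrow> 'x).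
        prob_space P \<and> martingale_on P G UNIV m \<longrightarrow>
        (SUP k. \<integral>\<^sup>+\<omega>. ennreal ((norm (m k \<omega>))\<^sup>2) \<partial>P)
          \<le> ennreal C *
             (\<Sum>k. \<integral>\<^sup>+\<omega>. ennreal ((norm (m k \<omega> - (if k = 0 then 0 else m (k - 1) \<omega>)))\<^sup>2) \<partial>P)))"

section \<open>Stationary Poisson point processes\<close>

text \<open>A point function is a partial map from \<open>(0,\<infinity>)\<close> to \<open>Z\<close> with countable domain. Its counting measure
  \<open>N(A) = #{s \<in> dom p. (s, p s) \<in> A}\<close> is the image of counting measure on the domain.\<close>

definition counting_measure ::
  "(real \<rightharpoonup> 'z::{banach, second_countable_topology}) \<Rightarrow> (real \<times> 'z) measure" where
  "counting_measure q = distr (count_space (dom q)) (borel \<Otimes>\<^sub>M borel) (\<lambda>s. (s, the (q s)))"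

definition stationary_poisson_point_process ::
  "'w measure \<Rightarrow> (real \<Rightarrow> 'w measure) \<Rightarrow> 'z::{banach, second_countable_topology} measure \<Rightarrow>
   ('w \<Rightarrow> real \<rightharpoonup> 'z) \<Rightarrow> bool" where
  "stationary_poisson_point_process M \<F> \<nu> p \<longleftrightarrow>
     (let N = (\<lambda>\<omega>. counting_measure (p \<omega>));
          \<A> = {A \<in> sets (borel \<Otimes>\<^sub>M borel). A \<subseteq> {0<..} \<times> UNIV};
          \<Lambda> = lborel \<Otimes>\<^sub>M \<nu>
      in
        (\<forall>\<omega>\<in>space M. countable (dom (p \<omega>)) \<and> dom (p \<omega>) \<subseteq> {0<..}) \<and>
        \<comment> \<open>Poisson random measure with intensity \<open>dt \<nu>(dz)\<close>\<close>
        (\<forall>A\<in>\<A>. (\<lambda>\<omega>. emeasure (N \<omega>) A) \<in> borel_measurable M) \<and>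
        (\<forall>A\<in>\<A>. emeasure \<Lambda> A < \<infinity> \<longrightarrow>
           (\<forall>n::nat. measure M {\<omega>\<in>space M. emeasure (N \<omega>) A = of_nat n}
                      = measure \<Lambda> A ^ n / fact n * exp (- measure \<Lambda> A))) \<and>
        (\<forall>A\<in>\<A>. emeasure \<Lambda> A = \<infinity> \<longrightarrow> (AE \<omega> in M. emeasure (N \<omega>) A = \<infinity>)) \<and>
        (\<forall>(A :: nat \<Rightarrow> (real \<times> 'z) set) n. A ` {..<n} \<subseteq> \<A> \<and> disjoint_family_on A {..<n} \<longrightarrow>
           prob_space.indep_vars M (\<lambda>_. borel) (\<lambda>i \<omega>. emeasure (N \<omega>) (A i)) {..<n}) \<and>
        \<comment> \<open>adaptedness and the martingale property of the compensated measure\<close>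
        (\<forall>t\<ge>0. \<forall>U\<in>sets borel. (\<lambda>\<omega>. emeasure (N \<omega>) ({0<..t} \<times> U)) \<in> borel_measurable (\<F> t)) \<and>
        (\<forall>U\<in>sets borel. martingale_on M \<F> {0..}
           (\<lambda>t \<omega>. measure (N \<omega>) ({0<..t} \<times> U) - t * measure \<nu> U)))"

section \<open>Set-valued random variables\<close>

definition set_measurable ::
  "'w measure \<Rightarrow> ('w \<Rightarrow> 'x::{banach, second_countable_topology} set) \<Rightarrow> bool" where
  "set_measurable G F \<longleftrightarrow>
     (\<forall>\<omega>\<in>space G. F \<omega> \<noteq> {} \<and> closed (F \<omega>)) \<and>
     (\<forall>U. open U \<longrightarrow> {\<omega>\<in>space G. F \<omega> \<inter> U \<noteq> {}} \<in> sets G)"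

definition norm_K :: "'x::real_normed_vector set \<Rightarrow> ennreal" where
  "norm_K A = (SUP a\<in>A. ennreal (norm a))"

definition integrably_bounded ::
  "'w measure \<Rightarrow> ('w \<Rightarrow> 'x::{banach, second_countable_topology} set) \<Rightarrow> bool" where
  "integrably_bounded M F \<longleftrightarrow>
     (\<lambda>\<omega>. norm_K (F \<omega>)) \<in> borel_measurable M \<and> (\<integral>\<^sup>+\<omega>. norm_K (F \<omega>) \<partial>M) < \<infinity>"

definition S1 ::
  "'w measure \<Rightarrow> 'w measure \<Rightarrow> ('w \<Rightarrow> 'x::{banach, second_countable_topology} set) \<Rightarrow> ('w \<Rightarrow> 'x) set" where
  "S1 M G F = {f \<in> L1 M G. AE \<omega> in M. f \<omega> \<in> F \<omega>}"

text \<open>\<open>H\<close> is a version of \<open>E[F | G]\<close>.\<close>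

definition has_set_cond_exp ::
  "'w measure \<Rightarrow> 'w measure \<Rightarrow> ('w \<Rightarrow> 'x::{banach, second_countable_topology} set) \<Rightarrow>
   ('w \<Rightarrow> 'x set) \<Rightarrow> bool" where
  "has_set_cond_exp M G F H \<longleftrightarrow> set_measurable G H \<and>
     S1 M G H = L1_closure M G {h. \<exists>f\<in>S1 M M F. has_cond_exp M G f h}"

text \<open>Convexity of the values is required almost surely, so that the notion does not depend on the
  choice of versions.\<close>

definition set_valued_martingale ::
  "'w measure \<Rightarrow> (real \<Rightarrow> 'w measure) \<Rightarrow> real set \<Rightarrow>
   (real \<Rightarrow> 'w \<Rightarrow> 'x::{banach, second_countable_topology} set) \<Rightarrow> bool" where
  "set_valued_martingale M \<F> J X \<longleftrightarrow>
     (\<forall>t\<in>J. set_measurable (\<F> t) (X t) \<and> integrably_bounded M (X t) \<and>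
            (AE \<omega> in M. convex (X t \<omega>))) \<and>
     (\<forall>s\<in>J. \<forall>t\<in>J. s \<le> t \<longrightarrow>
        (\<exists>H. has_set_cond_exp M (\<F> s) (X t) H \<and> S1 M (\<F> s) H = S1 M (\<F> s) (X s)))"

section \<open>Integrands\<close>

text \<open>The \<open>\<sigma>\<close>-algebra \<open>\<S>\<close> is generated by \<open>'x\<close>-valued functions, hence the type argument.\<close>

definition predictable_generators ::
  "(real \<Rightarrow> 'w measure) \<Rightarrow> real \<Rightarrow>
   (real \<times> 'z::{banach, second_countable_topology} \<times> 'w \<Rightarrow> 'x::{banach, second_countable_topology}) set" where
  "predictable_generators \<F> T = {g.
     (\<forall>t\<in>{0..T}. (\<lambda>(z, \<omega>). g (t, z, \<omega>)) \<in> borel_measurable (borel \<Otimes>\<^sub>M \<F> t)) \<and>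
     (\<forall>z. \<forall>\<omega>\<in>space (\<F> 0). \<forall>t\<in>{0<..T}. continuous (at_left t) (\<lambda>s. g (s, z, \<omega>)))}"

definition predictable_sigma ::
  "'x::{banach, second_countable_topology} itself \<Rightarrow> 'w measure \<Rightarrow> (real \<Rightarrow> 'w measure) \<Rightarrow> real \<Rightarrow>
   (real \<times> 'z::{banach, second_countable_topology} \<times> 'w) measure" where
  "predictable_sigma X M \<F> T = sigma ({0..T} \<times> UNIV \<times> space M)
     {g -` B \<inter> ({0..T} \<times> UNIV \<times> space M) | (g :: real \<times> 'z \<times> 'w \<Rightarrow> 'x) B.
        g \<in> predictable_generators \<F> T \<and> B \<in> sets borel}"

definition \<L>_space ::
  "'w measure \<Rightarrow> (real \<Rightarrow> 'w measure) \<Rightarrow> 'z::{banach, second_countable_topology} measure \<Rightarrow> real \<Rightarrow>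
   (real \<times> 'z \<times> 'w \<Rightarrow> 'x::{banach, second_countable_topology}) set" where
  "\<L>_space M \<F> \<nu> T = {f. f \<in> borel_measurable (predictable_sigma TYPE('x) M \<F> T) \<and>
     (\<integral>\<^sup>+\<omega>. (\<integral>\<^sup>+t\<in>{0..T}. (\<integral>\<^sup>+z. ennreal ((norm (f (t, z, \<omega>)))\<^sup>2) \<partial>\<nu>) \<partial>lborel) \<partial>M) < \<infinity>}"

definition \<M>_space ::
  "'w measure \<Rightarrow> (real \<Rightarrow> 'w measure) \<Rightarrow> 'z::{banach, second_countable_topology} measure \<Rightarrow> real \<Rightarrow>
   (real \<times> 'z \<times> 'w \<Rightarrow> 'x::{banach, second_countable_topology} set) set" where
  "\<M>_space M \<F> \<nu> T = {F. set_measurable (predictable_sigma TYPE('x) M \<F> T) F \<and>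
     (\<integral>\<^sup>+\<omega>. (\<integral>\<^sup>+t\<in>{0..T}. (\<integral>\<^sup>+z. (norm_K (F (t, z, \<omega>)))\<^sup>2 \<partial>\<nu>) \<partial>lborel) \<partial>M) < \<infinity>}"

definition selections ::
  "'w measure \<Rightarrow> (real \<Rightarrow> 'w measure) \<Rightarrow> 'z::{banach, second_countable_topology} measure \<Rightarrow> real \<Rightarrow>
   (real \<times> 'z \<times> 'w \<Rightarrow> 'x::{banach, second_countable_topology} set) \<Rightarrow> (real \<times> 'z \<times> 'w \<Rightarrow> 'x) set" where
  "selections M \<F> \<nu> T F = {f \<in> \<L>_space M \<F> \<nu> T.
     AE x in (restrict_space lborel {0..T} \<Otimes>\<^sub>M (\<nu> \<Otimes>\<^sub>M M)). f x \<in> F x}"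

definition nondegenerate_convex_process ::
  "'w measure \<Rightarrow> 'z::{banach, second_countable_topology} measure \<Rightarrow> real \<Rightarrow>
   (real \<times> 'z \<times> 'w \<Rightarrow> 'x::{banach, second_countable_topology} set) \<Rightarrow> bool" where
  "nondegenerate_convex_process M \<nu> T F \<longleftrightarrow>
     (\<forall>t\<in>{0..T}. AE (z, \<omega>) in \<nu> \<Otimes>\<^sub>M M.
        closed (F (t, z, \<omega>)) \<and> convex (F (t, z, \<omega>)) \<and> infinite (F (t, z, \<omega>)))"

section \<open>Integrals\<close>

definition compensated_integral ::
  "'z::{banach, second_countable_topology} measure \<Rightarrow> ('w \<Rightarrow> real \<rightharpoonup> 'z) \<Rightarrow>
   (real \<times> 'z \<times> 'w \<Rightarrow> 'x::{banach, second_countable_topology}) \<Rightarrow> real \<Rightarrow> 'w \<Rightarrow> 'x" where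
  "compensated_integral \<nu> p f t \<omega> =
     (LINT (s, z):{0<..t} \<times> UNIV|counting_measure (p \<omega>). f (s, z, \<omega>)) -
     (LINT (s, z):{0<..t} \<times> UNIV|lborel \<Otimes>\<^sub>M \<nu>. f (s, z, \<omega>))"

definition decomposable_hull ::
  "'w measure \<Rightarrow> ('w \<Rightarrow> 'x::real_vector) set \<Rightarrow> ('w \<Rightarrow> 'x) set" where
  "decomposable_hull G \<Gamma> =
     {(\<lambda>\<omega>. \<Sum>i<m. indicator (A i) \<omega> *\<^sub>R g i \<omega>) | (m::nat) A g.
        m \<ge> 1 \<and> A ` {..<m} \<subseteq> sets G \<and> disjoint_family_on A {..<m} \<and>
        (\<Union>i<m. A i) = space G \<and> g ` {..<m} \<subseteq> \<Gamma>}"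

text \<open>\<open>V\<close> is a version of \<open>I\<^sub>t(F)\<close>, which is determined only up to almost sure equality.\<close>

definition is_set_integral ::
  "'w measure \<Rightarrow> (real \<Rightarrow> 'w measure) \<Rightarrow> 'z::{banach, second_countable_topology} measure \<Rightarrow>
   ('w \<Rightarrow> real \<rightharpoonup> 'z) \<Rightarrow> real \<Rightarrow>
   (real \<times> 'z \<times> 'w \<Rightarrow> 'x::{banach, second_countable_topology} set) \<Rightarrow> real \<Rightarrow> ('w \<Rightarrow> 'x set) \<Rightarrow> bool" where
  "is_set_integral M \<F> \<nu> p T F t V \<longleftrightarrow> set_measurable (\<F> t) V \<and>
     S1 M (\<F> t) V = L1_closure M M (decomposable_hull (\<F> t)
       {compensated_integral \<nu> p f t | f. f \<in> selections M \<F> \<nu> T F})"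

end

theory Submission
  imports Defs
begin

text \<open>Write \<open>J\<^sub>t f\<close> for the compensated integral of a selection \<open>f\<close> of \<open>F\<close> up to time \<open>t\<close>, and let \<open>B\<^sub>s\<close>
  be the event that the point process has no point with time in \<open>(0, s]\<close>. On \<open>B\<^sub>s\<close> the random
  measure gives no contribution, so that \<open>J\<^sub>s f\<close> is just minus a Lebesgue integral:
  \<open>J\<^sub>s f = - \<integral>\<^sub>0\<^sup>s \<integral> f d\<nu> dr\<close>. Two consequences of this observation contradict each other.

  \<^emph>\<open>A set-valued martingale has only centred selections.\<close> Suppose that \<open>I\<close> is a martingale and \<open>\<xi>\<close>
  is an integrable selection of \<open>I\<^sub>T\<close>. Then \<open>E[\<xi> | \<F>\<^sub>s]\<close> is a selection of \<open>I\<^sub>s\<close>, hence an \<open>L\<^sup>1\<close> limit of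
  patched integrals \<open>\<Sum> \<chi>\<^bsub>A\<^sub>i\<^esub> J\<^sub>s f\<^sub>i\<close>, and on \<open>B\<^sub>s\<close> all of these are bounded in norm by
  \<open>\<integral>\<^sub>0\<^sup>s \<integral> \<parallel>F\<parallel> d\<nu> dr\<close>. As \<open>B\<^sub>s\<close> belongs to \<open>\<F>\<^sub>s\<close>, the norm of \<open>E[\<chi>\<^bsub>B\<^sub>s\<^esub> \<xi>]\<close> is at most the
  expectation of that bound. For \<open>s \<rightarrow> 0\<close> the bound vanishes while \<open>B\<^sub>s\<close> increases to a set of full
  probability, and therefore \<open>E \<xi> = 0\<close> (lemma \<open>martingale_selection_mean_zero\<close>).

  \<^emph>\<open>Patching produces selections that are not centred.\<close> Fix an integrable element \<open>\<eta>\<close> of the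
  decomposable hull at time \<open>T\<close>. For every selection \<open>f\<close> of \<open>F\<close>, the function equal to \<open>J\<^sub>T f\<close> on \<open>B\<^sub>T\<close>
  and to \<open>\<eta>\<close> off \<open>B\<^sub>T\<close> is an integrable selection of \<open>I\<^sub>T\<close>. It is centred, and so the integral of
  \<open>f\<close> over \<open>B\<^sub>T \<times> (0, T] \<times> Z\<close> does not depend on \<open>f\<close>. Selections of \<open>F\<close> may be switched along any
  predictable set \<open>D\<close>; this turns the equality into \<open>\<integral>\<^sub>D (f - g) = 0\<close> for all \<open>D\<close>, and hence
  \<open>f = g\<close> almost everywhere on \<open>B\<^sub>T\<close> (lemma \<open>martingale_unique_selection\<close>). But \<open>B\<^sub>T\<close> has positive
  probability \<open>exp (- T \<nu>(Z))\<close>, and a Castaing representation of \<open>F\<close> then shows that \<open>F\<close> is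
  single-valued on a set of positive measure, although its values are infinite.

  The argument rests on three general tools proved below: measurable selections of closed-valued
  maps (\<open>measurable_selection\<close>, \<open>Castaing_representation\<close>), conditional expectations of
  Banach-valued functions (\<open>cond_exp_exists\<close>), and the joint measurability of predictable
  functions (\<open>predictable_jointly_measurable\<close>), which makes Fubini's theorem applicable.\<close>

section \<open>Measurable selections\<close>

lemma set_measurableD:
  assumes "set_measurable G F"
  shows "\<omega> \<in> space G \<Longrightarrow> F \<omega> \<noteq> {}" "\<omega> \<in> space G \<Longrightarrow> closed (F \<omega>)"
    "open U \<Longrightarrow> {\<omega>\<in>space G. F \<omega> \<inter> U \<noteq> {}} \<in> sets G"
  using assms unfolding set_measurable_def by auto

lemma exists_dense_sequence:
  obtains d :: "nat \<Rightarrow> 'x::second_countable_topology"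
  where "\<And>U. open U \<Longrightarrow> U \<noteq> {} \<Longrightarrow> \<exists>k. d k \<in> U"
proof -
  obtain D :: "'x set" where D: "countable D" "\<And>U. open U \<Longrightarrow> U \<noteq> {} \<Longrightarrow> \<exists>x\<in>D. x \<in> U"
    by (rule countable_dense_setE) blast
  have "D \<noteq> {}" using D(2)[of UNIV] by auto
  then have "\<exists>k. from_nat_into D k \<in> U" if "open U" "U \<noteq> {}" for U
    using D that by (metis from_nat_into_surj)
  then show thesis by (rule that)
qed

text \<open>The Kuratowski--Ryll-Nardzewski selection theorem. Approximate selections \<open>d \<circ> K n\<close> with values in
  a dense sequence \<open>d\<close> are chosen recursively, always taking the least admissible index: the value must be
  within \<open>(1/2)\<^sup>n\<close> of the set and close to the previous value. Choosing the least index keeps everything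
  measurable, and the sequence converges geometrically to a point of the closed set.\<close>

theorem measurable_selection:
  fixes F :: "'a \<Rightarrow> 'x::{banach, second_countable_topology} set"
  assumes F: "set_measurable G F"
  obtains f where "f \<in> borel_measurable G" "\<And>\<omega>. \<omega> \<in> space G \<Longrightarrow> f \<omega> \<in> F \<omega>"
proof -
  obtain d :: "nat \<Rightarrow> 'x" where d: "\<And>U. open U \<Longrightarrow> U \<noteq> {} \<Longrightarrow> \<exists>k. d k \<in> U"
    by (rule exists_dense_sequence) blast
  define r :: "nat \<Rightarrow> real" where "r n = (1/2)^n" for n
  have r: "r n > 0" for n by (simp add: r_def)
  define near where "near n \<omega> j k \<longleftrightarrow> F \<omega> \<inter> (ball (d k) (r (Suc n)) \<inter> ball (d j) (r n)) \<noteq> {}"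
    for n \<omega> j k
  define K where "K = rec_nat (\<lambda>\<omega>. LEAST k. F \<omega> \<inter> ball (d k) (r 0) \<noteq> {})
     (\<lambda>n kn \<omega>. LEAST k. near n \<omega> (kn \<omega>) k)"
  have K0: "K 0 = (\<lambda>\<omega>. LEAST k. F \<omega> \<inter> ball (d k) (r 0) \<noteq> {})"
    and KS: "K (Suc n) = (\<lambda>\<omega>. LEAST k. near n \<omega> (K n \<omega>) k)" for n
    by (simp_all add: K_def)
  have [measurable]: "K n \<in> measurable G (count_space UNIV)" for n
  proof (induction n)
    case 0
    have "Measurable.pred G (\<lambda>\<omega>. F \<omega> \<inter> ball (d k) (r 0) \<noteq> {})" for k
      using set_measurableD(3)[OF F, of "ball (d k) (r 0)"] by (auto simp: pred_def)
    then show ?case unfolding K0 by (rule measurable_Least)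
  next
    case (Suc n)
    have "Measurable.pred G (\<lambda>\<omega>. near n \<omega> j k)" for j k
      unfolding near_def pred_def
      by (intro set_measurableD(3)[OF F] open_Int open_ball)
    then have "Measurable.pred G (\<lambda>\<omega>. near n \<omega> (K n \<omega>) k)" for k
      by (rule measurable_compose_countable[OF _ Suc])
    then show ?case unfolding KS by (rule measurable_Least)
  qed
  have hit: "F \<omega> \<inter> ball (d (K n \<omega>)) (r n) \<noteq> {}" if w: "\<omega> \<in> space G" for n \<omega>
  proof (induction n)
    case 0
    obtain a where a: "a \<in> F \<omega>" using set_measurableD(1)[OF F w] by auto
    obtain k where "d k \<in> ball a (r 0)" using d[of "ball a (r 0)"] r[of 0] by (auto simp: not_le)
    then have "F \<omega> \<inter> ball (d k) (r 0) \<noteq> {}" using a by (auto simp: dist_commute)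
    then show ?case unfolding K0 by (rule LeastI)
  next
    case (Suc n)
    then obtain a where a: "a \<in> F \<omega>" "a \<in> ball (d (K n \<omega>)) (r n)" by blast
    obtain k where "d k \<in> ball a (r (Suc n))" using d[of "ball a (r (Suc n))"] r[of "Suc n"] by (auto simp: not_le)
    then have "near n \<omega> (K n \<omega>) k" using a by (auto simp: dist_commute near_def)
    then have "near n \<omega> (K n \<omega>) (K (Suc n) \<omega>)" unfolding KS by (rule LeastI)
    then show ?case by (auto simp: near_def)
  qed
  have step: "norm (d (K (Suc n) \<omega>) - d (K n \<omega>)) \<le> 2 * r n" if w: "\<omega> \<in> space G" for n \<omega>
  proof -
    obtain a where a: "a \<in> F \<omega>" "a \<in> ball (d (K n \<omega>)) (r n)" using hit[OF w, of n] by blast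
    obtain k where "d k \<in> ball a (r (Suc n))" using d[of "ball a (r (Suc n))"] r[of "Suc n"] by (auto simp: not_le)
    then have "near n \<omega> (K n \<omega>) k" using a by (auto simp: dist_commute near_def)
    then have "near n \<omega> (K n \<omega>) (K (Suc n) \<omega>)" unfolding KS by (rule LeastI)
    then obtain b where "dist (d (K (Suc n) \<omega>)) b < r (Suc n)" "dist (d (K n \<omega>)) b < r n"
      by (auto simp: near_def)
    moreover have "r (Suc n) \<le> r n" by (simp add: r_def)
    ultimately show ?thesis
      using dist_triangle2[of "d (K (Suc n) \<omega>)" "d (K n \<omega>)" b] by (simp add: dist_norm)
  qed
  define f where "f \<omega> = lim (\<lambda>n. d (K n \<omega>))" for \<omega>
  have conv: "(\<lambda>n. d (K n \<omega>)) \<longlonglongrightarrow> f \<omega>" if "\<omega> \<in> space G" for \<omega>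
  proof -
    have "summable (\<lambda>n. d (K (Suc n) \<omega>) - d (K n \<omega>))"
      by (rule summable_comparison_test'[where g="\<lambda>n. 2 * r n" and N=0])
         (use step[OF that] in \<open>auto simp: r_def intro!: summable_mult summable_geometric\<close>)
    then have "convergent (\<lambda>n. \<Sum>i<n. d (K (Suc i) \<omega>) - d (K i \<omega>))"
      by (simp add: summable_iff_convergent)
    then have "convergent (\<lambda>n. d (K n \<omega>) - d (K 0 \<omega>))"
      by (simp add: sum_lessThan_telescope[of "\<lambda>n. d (K n \<omega>)"])
    then have "convergent (\<lambda>n. d (K n \<omega>))"
      by (simp add: convergent_diff_const_right_iff)
    then show ?thesis by (simp add: f_def convergent_LIMSEQ_iff)
  qed
  show thesis
  proof (rule that)
    have "(\<lambda>\<omega>. d (K n \<omega>)) \<in> borel_measurable G" for n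
      by (rule measurable_compose[of "K n" G "count_space UNIV" d]) auto
    then show "f \<in> borel_measurable G"
      by (rule borel_measurable_LIMSEQ_metric) (rule conv)
  next
    fix \<omega> assume w: "\<omega> \<in> space G"
    obtain a where a: "\<And>n. a n \<in> F \<omega>" "\<And>n. dist (d (K n \<omega>)) (a n) < r n"
      using hit[OF w] by (simp add: ex_in_conv[symmetric]) metis
    have r0: "r \<longlonglongrightarrow> 0" unfolding r_def[abs_def] by (rule LIMSEQ_power_zero) simp
    have "(\<lambda>n. norm (a n - d (K n \<omega>))) \<longlonglongrightarrow> 0"
      by (rule tendsto_sandwich[OF _ _ tendsto_const r0])
         (use a(2) in \<open>auto simp: less_imp_le dist_norm norm_minus_commute intro!: always_eventually\<close>)
    then have "a \<longlonglongrightarrow> f \<omega>"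
      by (intro Lim_transform[OF conv[OF w]] tendsto_norm_zero_cancel[of "\<lambda>n. a n - d (K n \<omega>)"])
    then show "f \<omega> \<in> F \<omega>"
      using closed_sequentially[OF set_measurableD(2)[OF F w]] a(1) by blast
  qed
qed

text \<open>Apply the selection theorem to the localised maps \<open>closure (F \<inter> U)\<close>, with \<open>U\<close> running through a
  countable basis; where \<open>F\<close> misses \<open>U\<close> the localised map falls back to \<open>F\<close> itself, which keeps its
  values nonempty. A selection localised to a small neighbourhood of a point of \<open>F\<close> is
  close to that point.\<close>

corollary Castaing_representation:
  fixes F :: "'a \<Rightarrow> 'x::{banach, second_countable_topology} set"
  assumes F: "set_measurable G F"
  obtains f :: "nat \<Rightarrow> 'a \<Rightarrow> 'x"
  where "\<And>n. f n \<in> borel_measurable G" "\<And>n \<omega>. \<omega> \<in> space G \<Longrightarrow> f n \<omega> \<in> F \<omega>"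
    "\<And>\<omega>. \<omega> \<in> space G \<Longrightarrow> F \<omega> \<subseteq> closure (range (\<lambda>n. f n \<omega>))"
proof -
  obtain \<B> :: "'x set set" where B: "countable \<B>" "topological_basis \<B>"
    using ex_countable_basis by auto
  have "\<B> \<noteq> {}"
    using topological_basisE[OF B(2) open_UNIV, of 0] by blast
  have openB: "open (from_nat_into \<B> n)" for n
    using topological_basis_open[OF B(2) from_nat_into[OF \<open>\<B> \<noteq> {}\<close>]] .
  define C where "C n \<omega> = (let U = from_nat_into \<B> n in
     if F \<omega> \<inter> U \<noteq> {} then closure (F \<omega> \<inter> U) else F \<omega>)" for n \<omega>
  have C: "set_measurable G (C n)" for n
    unfolding set_measurable_def
  proof (intro conjI allI impI ballI)
    fix O' :: "'x set" assume O': "open O'"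
    let ?U = "from_nat_into \<B> n"
    have "{\<omega>\<in>space G. C n \<omega> \<inter> O' \<noteq> {}} =
       {\<omega>\<in>space G. F \<omega> \<inter> (?U \<inter> O') \<noteq> {}} \<union>
       ({\<omega>\<in>space G. F \<omega> \<inter> O' \<noteq> {}} - {\<omega>\<in>space G. F \<omega> \<inter> ?U \<noteq> {}})"
      using open_Int_closure_eq_empty[OF O'] by (auto simp: C_def Let_def Int_ac split: if_splits)
    then show "{\<omega>\<in>space G. C n \<omega> \<inter> O' \<noteq> {}} \<in> sets G"
      using set_measurableD(3)[OF F open_Int[OF openB[of n] O']]
        set_measurableD(3)[OF F openB[of n]] set_measurableD(3)[OF F O'] by (simp add: sets.Un sets.Diff)
  qed (use set_measurableD[OF F] in \<open>auto simp: C_def Let_def closure_eq_empty\<close>)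
  have "\<exists>f. f \<in> borel_measurable G \<and> (\<forall>\<omega>\<in>space G. f \<omega> \<in> C n \<omega>)" for n
    by (rule measurable_selection[OF C[of n]]) blast
  then obtain f where f: "\<And>n. f n \<in> borel_measurable G" "\<And>n \<omega>. \<omega> \<in> space G \<Longrightarrow> f n \<omega> \<in> C n \<omega>"
    by metis
  show thesis
  proof (rule that[of f])
    fix n \<omega> assume w: "\<omega> \<in> space G"
    have "C n \<omega> \<subseteq> F \<omega>"
      using set_measurableD(2)[OF F w] by (auto simp: C_def Let_def intro: closure_minimal[THEN subsetD, rotated])
    then show "f n \<omega> \<in> F \<omega>" using f(2)[OF w] by blast
  next
    fix \<omega> assume w: "\<omega> \<in> space G"
    show "F \<omega> \<subseteq> closure (range (\<lambda>n. f n \<omega>))"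
    proof (rule subsetI, rule closure_approachable[THEN iffD2], intro allI impI)
      fix a and e :: real assume a: "a \<in> F \<omega>" and e: "e > 0"
      obtain U where U: "U \<in> \<B>" "a \<in> U" "U \<subseteq> ball a (e/2)"
        using topological_basisE[OF B(2) open_ball[of a "e/2"], of a] e by auto
      obtain n where n: "from_nat_into \<B> n = U"
        using from_nat_into_surj[OF B(1) U(1)] by blast
      have "C n \<omega> \<subseteq> closure U"
        using a U(2) by (auto simp: C_def n Let_def intro: closure_mono[THEN subsetD, rotated])
      also have "\<dots> \<subseteq> cball a (e/2)"
        using U(3) by (intro closure_minimal) auto
      finally have "dist (f n \<omega>) a \<le> e/2" using f(2)[OF w, of n] by (auto simp: dist_commute)
      then show "\<exists>y\<in>range (\<lambda>n. f n \<omega>). dist y a < e" using e by (intro bexI[of _ "f n \<omega>"]) auto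
    qed
  qed (rule f(1))
qed

section \<open>Vanishing integrals\<close>

text \<open>If \<open>h\<close> did not vanish almost everywhere, it would take values in a ball around some \<open>y \<noteq> 0\<close> of
  radius \<open>\<parallel>y\<parallel>/2\<close> on a set of positive measure. The average of \<open>h\<close> over the preimage of that ball would then be within
  \<open>\<parallel>y\<parallel>/2\<close> of \<open>y\<close> and could not be \<open>0\<close>. The test sets are preimages under \<open>h\<close>,
  which makes them predictable when \<open>h\<close> is.\<close>

lemma AE_zero_if_integrals_zero:
  fixes h :: "'a \<Rightarrow> 'x::{banach, second_countable_topology}"
  assumes h: "integrable N h"
    and zero: "\<And>A. A \<in> sets borel \<Longrightarrow> set_lebesgue_integral N (h -` A \<inter> space N) h = 0"
  shows "AE x in N. h x = 0"
proof -
  have [measurable]: "h \<in> borel_measurable N" using h by simp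
  obtain d :: "nat \<Rightarrow> 'x" where d: "\<And>U. open U \<Longrightarrow> U \<noteq> {} \<Longrightarrow> \<exists>k. d k \<in> U"
    by (rule exists_dense_sequence) blast
  define A where "A k = h -` cball (d k) (norm (d k) / 2) \<inter> space N" for k
  have [measurable]: "A k \<in> sets N" for k by (auto simp: A_def)
  have ge: "norm (d k) / 2 \<le> norm (h x)" "norm (h x - d k) \<le> norm (d k) / 2" if "x \<in> A k" for x k
    using that norm_triangle_sub[of "d k" "h x"] by (auto simp: A_def dist_norm norm_minus_commute)
  have "AE x in N. x \<notin> A k" if "d k \<noteq> 0" for k
  proof -
    \<comment> \<open>the measure of \<open>A k\<close> is finite because \<open>norm (h x) \<ge> norm (d k) / 2 > 0\<close> there\<close>
    have "emeasure N (A k) < \<infinity>"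
    proof -
      have "emeasure N (A k) = (\<integral>\<^sup>+x. indicator (A k) x \<partial>N)" by simp
      also have "\<dots> \<le> (\<integral>\<^sup>+x. ennreal (2 / norm (d k)) * ennreal (norm (h x)) \<partial>N)"
        using that ge(1)[of _ k]
        by (intro nn_integral_mono)
           (auto split: split_indicator simp: ennreal_mult[symmetric] field_simps ennreal_ge_1)
      also have "\<dots> = ennreal (2 / norm (d k)) * (\<integral>\<^sup>+x. ennreal (norm (h x)) \<partial>N)"
        by (rule nn_integral_cmult) simp
      also have "\<dots> < \<infinity>"
        using h by (auto simp: integrable_iff_bounded ennreal_mult_less_top)
      finally show ?thesis .
    qed
    then have fin: "emeasure N (A k) \<noteq> \<infinity>" by simp
    have ih: "integrable N (\<lambda>x. indicator (A k) x *\<^sub>R h x)"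
      by (intro integrable_mult_indicator h) simp
    have ic: "integrable N (\<lambda>x. indicator (A k) x *\<^sub>R d k)"
      using fin by (simp add: less_top)
    have "measure N (A k) * norm (d k) = norm (\<integral>x. indicator (A k) x *\<^sub>R d k \<partial>N)"
      using fin by (simp add: less_top)
    also have "\<dots> = norm (\<integral>x. indicator (A k) x *\<^sub>R h x - indicator (A k) x *\<^sub>R d k \<partial>N)"
      using zero[of "cball (d k) (norm (d k) / 2)"] ih ic
      by (simp add: Bochner_Integration.integral_diff set_lebesgue_integral_def A_def)
    also have "\<dots> \<le> (\<integral>x. norm (indicator (A k) x *\<^sub>R h x - indicator (A k) x *\<^sub>R d k) \<partial>N)"
      by (rule integral_norm_bound)
    also have "\<dots> \<le> (\<integral>x. indicator (A k) x * (norm (d k) / 2) \<partial>N)"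
      using ge(2) fin ih ic
      by (intro integral_mono) (auto split: split_indicator simp: less_top)
    also have "\<dots> = measure N (A k) * (norm (d k) / 2)"
      using fin by (simp add: less_top)
    finally have "measure N (A k) = 0"
      using that measure_nonneg[of N "A k"] by (simp add: field_simps mult_le_0_iff)
    then have "A k \<in> null_sets N" using fin by (auto simp: null_sets_def measure_def enn2real_eq_0_iff)
    then show ?thesis by (rule AE_not_in)
  qed
  then have "AE x in N. \<forall>k. d k \<noteq> 0 \<longrightarrow> x \<notin> A k" by (auto simp: AE_all_countable)
  then show ?thesis
  proof (rule AE_mp, intro AE_I2 impI)
    fix x assume x: "x \<in> space N" and *: "\<forall>k. d k \<noteq> 0 \<longrightarrow> x \<notin> A k"
    show "h x = 0"
    proof (rule ccontr)
      assume "h x \<noteq> 0"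
      then obtain k where "d k \<in> ball (h x) (norm (h x) / 3)" using d[of "ball (h x) (norm (h x) / 3)"] by auto
      then have "norm (h x - d k) < norm (h x) / 3" by (simp add: dist_norm)
      moreover have "norm (h x) \<le> norm (d k) + norm (h x - d k)" by (rule norm_triangle_sub)
      ultimately have "d k \<noteq> 0 \<and> x \<in> A k" using x \<open>h x \<noteq> 0\<close>
        by (auto simp: A_def dist_norm norm_minus_commute)
      then show False using * by blast
    qed
  qed
qed

section \<open>Conditional expectations in Banach spaces\<close>

lemma has_cond_exp_sum:
  assumes "subalgebra M G" and "\<And>i. i \<in> J \<Longrightarrow> has_cond_exp M G (f i) (h i)"
  shows "has_cond_exp M G (\<lambda>\<omega>. \<Sum>i\<in>J. f i \<omega>) (\<lambda>\<omega>. \<Sum>i\<in>J. h i \<omega>)"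
proof -
  have f: "integrable M (f i)" and h: "integrable M (h i)" "h i \<in> borel_measurable G" if "i \<in> J" for i
    using assms(2)[OF that] by (auto simp: has_cond_exp_def L1_def)
  have "set_lebesgue_integral M A (\<lambda>\<omega>. \<Sum>i\<in>J. h i \<omega>) = set_lebesgue_integral M A (\<lambda>\<omega>. \<Sum>i\<in>J. f i \<omega>)"
    if A: "A \<in> sets G" for A
  proof -
    have AM: "A \<in> sets M" using A assms(1) by (auto simp: subalgebra_def)
    have "(\<Sum>i\<in>J. \<integral>\<omega>. indicator A \<omega> *\<^sub>R h i \<omega> \<partial>M) = (\<Sum>i\<in>J. \<integral>\<omega>. indicator A \<omega> *\<^sub>R f i \<omega> \<partial>M)"
      using assms(2) A by (intro sum.cong) (auto simp: has_cond_exp_def set_lebesgue_integral_def)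
    then show ?thesis
      using f h AM
      by (simp add: set_lebesgue_integral_def scaleR_sum_right integral_sum integrable_mult_indicator)
  qed
  then show ?thesis
    unfolding has_cond_exp_def L1_def using f h by auto
qed

text \<open>The conditional expectation of a real indicator is nonnegative, so that taking norms loses nothing: the conditioned
  atom has the \<open>L\<^sup>1\<close> norm of the atom. As the atoms of a simple function have disjoint supports, their norms add up to the
  norm of the function, and \<open>has_cond_exp_simple\<close> obtains the contraction property.\<close>

lemma has_cond_exp_indicator:
  fixes y :: "'x::{banach, second_countable_topology}"
  assumes "finite_measure M" "subalgebra M G" and A: "A \<in> sets M"
  shows "has_cond_exp M G (\<lambda>\<omega>. indicator A \<omega> *\<^sub>R y) (\<lambda>\<omega>. real_cond_exp M G (indicator A) \<omega> *\<^sub>R y)"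
    and "(\<integral>\<omega>. norm (real_cond_exp M G (indicator A) \<omega> *\<^sub>R y) \<partial>M) = measure M A * norm y"
proof -
  interpret finite_measure_subalgebra M G
    using assms by (simp add: finite_measure_subalgebra_def finite_measure_subalgebra_axioms_def)
  let ?q = "real_cond_exp M G (indicator A)"
  have iA: "integrable M (indicator A :: _ \<Rightarrow> real)"
    using A by (simp add: less_top[symmetric])
  have iq: "integrable M ?q" by (rule real_cond_exp_int(1)[OF iA])
  have "set_lebesgue_integral M B (\<lambda>\<omega>. ?q \<omega> *\<^sub>R y) = set_lebesgue_integral M B (\<lambda>\<omega>. indicator A \<omega> *\<^sub>R y)"
    if B: "B \<in> sets G" for B
  proof -
    have BM: "B \<in> sets M" using B assms(2) by (auto simp: subalgebra_def)
    have "set_lebesgue_integral M B (\<lambda>\<omega>. ?q \<omega> *\<^sub>R y) = (\<integral>\<omega>. (indicator B \<omega> * ?q \<omega>) *\<^sub>R y \<partial>M)"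
      by (simp add: set_lebesgue_integral_def)
    also have "\<dots> = (\<integral>\<omega>. indicator B \<omega> * ?q \<omega> \<partial>M) *\<^sub>R y"
      using integrable_mult_indicator[OF BM iq] by (intro integral_scaleR_left) simp
    also have "\<dots> = (\<integral>\<omega>. indicator B \<omega> * indicator A \<omega> \<partial>M) *\<^sub>R y"
      using real_cond_exp_intA[OF iA B] by (simp add: set_lebesgue_integral_def)
    also have "\<dots> = (\<integral>\<omega>. (indicator B \<omega> * indicator A \<omega>) *\<^sub>R y \<partial>M)"
      using integrable_mult_indicator[OF BM iA] by (intro integral_scaleR_left[symmetric]) simp
    finally show ?thesis by (simp add: set_lebesgue_integral_def)
  qed
  then show "has_cond_exp M G (\<lambda>\<omega>. indicator A \<omega> *\<^sub>R y) (\<lambda>\<omega>. ?q \<omega> *\<^sub>R y)"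
    using iA iq by (simp add: has_cond_exp_def L1_def)
  have "AE \<omega> in M. 0 \<le> ?q \<omega>"
    using A by (intro real_cond_exp_pos) auto
  then have "AE \<omega> in M. norm (?q \<omega> *\<^sub>R y) = ?q \<omega> * norm y" by eventually_elim simp
  then have "(\<integral>\<omega>. norm (?q \<omega> *\<^sub>R y) \<partial>M) = (\<integral>\<omega>. ?q \<omega> * norm y \<partial>M)"
    by (intro integral_cong_AE) auto
  also have "\<dots> = (\<integral>\<omega>. ?q \<omega> \<partial>M) * norm y" using iq by simp
  also have "(\<integral>\<omega>. ?q \<omega> \<partial>M) = measure M A" using real_cond_exp_int(2)[OF iA] A by simp
  finally show "(\<integral>\<omega>. norm (?q \<omega> *\<^sub>R y) \<partial>M) = measure M A * norm y" .
qed

lemma has_cond_exp_cong: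
  assumes "has_cond_exp M G f h" "\<And>\<omega>. \<omega> \<in> space M \<Longrightarrow> f \<omega> = g \<omega>"
  shows "has_cond_exp M G g h"
proof -
  have "integrable M f \<longleftrightarrow> integrable M g" using assms(2) by (intro Bochner_Integration.integrable_cong) auto
  moreover have "set_lebesgue_integral M A f = set_lebesgue_integral M A g" for A
    using assms(2) unfolding set_lebesgue_integral_def by (intro Bochner_Integration.integral_cong) auto
  ultimately show ?thesis using assms(1) by (simp add: has_cond_exp_def)
qed

lemma has_cond_exp_simple:
  fixes u :: "'w \<Rightarrow> 'x::{banach, second_countable_topology}"
  assumes M: "finite_measure M" "subalgebra M G" and u: "simple_function M u"
  shows "\<exists>h. has_cond_exp M G u h \<and> (\<integral>\<omega>. norm (h \<omega>) \<partial>M) \<le> (\<integral>\<omega>. norm (u \<omega>) \<partial>M)"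
proof -
  interpret finite_measure M by fact
  define A where "A y = u -` {y} \<inter> space M" for y
  have A[measurable]: "A y \<in> sets M" for y using u by (auto simp: A_def intro: simple_functionD)
  have fin: "finite (u ` space M)" using u by (rule simple_functionD)
  define h where "h \<omega> = (\<Sum>y\<in>u ` space M. real_cond_exp M G (indicator (A y)) \<omega> *\<^sub>R y)" for \<omega>
  have expand: "(\<Sum>y\<in>u ` space M. indicator (A y) \<omega> *\<^sub>R v y) = v (u \<omega>)" if "\<omega> \<in> space M"
    for \<omega> and v :: "'x \<Rightarrow> 'b::real_vector"
  proof -
    have "(\<Sum>y\<in>u ` space M. indicator (A y) \<omega> *\<^sub>R v y) = (\<Sum>y\<in>u ` space M. if y = u \<omega> then v y else 0)"
      using that by (intro sum.cong) (auto simp: A_def indicator_def)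
    then show ?thesis using that fin by simp
  qed
  have "has_cond_exp M G (\<lambda>\<omega>. \<Sum>y\<in>u ` space M. indicator (A y) \<omega> *\<^sub>R y) h"
    unfolding h_def by (intro has_cond_exp_sum M has_cond_exp_indicator) auto
  then have 1: "has_cond_exp M G u h"
    by (rule has_cond_exp_cong) (simp add: expand)
  have int: "integrable M (\<lambda>\<omega>. real_cond_exp M G (indicator (A y)) \<omega> *\<^sub>R y)" for y
    using has_cond_exp_indicator(1)[OF M, of "A y" y] by (auto simp: has_cond_exp_def L1_def)
  have "(\<integral>\<omega>. norm (h \<omega>) \<partial>M) \<le> (\<integral>\<omega>. (\<Sum>y\<in>u ` space M. norm (real_cond_exp M G (indicator (A y)) \<omega> *\<^sub>R y)) \<partial>M)"
    unfolding h_def using int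
    by (intro integral_mono norm_sum integrable_norm Bochner_Integration.integrable_sum)
  also have "\<dots> = (\<Sum>y\<in>u ` space M. measure M (A y) * norm y)"
    using integrable_norm[OF int]
    by (subst Bochner_Integration.integral_sum) (simp_all del: norm_scaleR add: has_cond_exp_indicator(2)[OF M A])
  also have "\<dots> = (\<Sum>y\<in>u ` space M. (\<integral>\<omega>. indicator (A y) \<omega> *\<^sub>R norm y \<partial>M))"
    by (simp add: less_top[symmetric])
  also have "\<dots> = (\<integral>\<omega>. (\<Sum>y\<in>u ` space M. indicator (A y) \<omega> *\<^sub>R norm y) \<partial>M)"
    by (rule Bochner_Integration.integral_sum[symmetric]) (simp add: less_top[symmetric])
  also have "\<dots> = (\<integral>\<omega>. norm (u \<omega>) \<partial>M)"
    by (intro Bochner_Integration.integral_cong expand) auto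
  finally show ?thesis using 1 by blast
qed

text \<open>Representing \<open>f\<close> as an absolutely convergent series reduces the existence of \<open>E[f | G]\<close> to the summation of the
  series of conditional expectations.\<close>

lemma integrable_eq_series_simple:
  fixes f :: "'w \<Rightarrow> 'x::{banach, second_countable_topology}"
  assumes "finite_measure M" and f: "integrable M f"
  obtains u where "\<And>i. simple_function M (u i)" "summable (\<lambda>i. \<integral>\<omega>. norm (u i \<omega>) \<partial>M)"
    "\<And>\<omega>. \<omega> \<in> space M \<Longrightarrow> (\<lambda>i. u i \<omega>) sums f \<omega>"
proof -
  interpret finite_measure M by fact
  have [measurable]: "f \<in> borel_measurable M" using f by simp
  obtain s where s: "\<And>i. simple_function M (s i)"
    and lim: "\<And>x. x \<in> space M \<Longrightarrow> (\<lambda>i. s i x) \<longlonglongrightarrow> f x"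
    and bound: "\<And>i x. x \<in> space M \<Longrightarrow> dist (s i x) 0 \<le> 2 * dist (f x) 0"
    using borel_measurable_implies_sequence_metric[OF \<open>f \<in> borel_measurable M\<close>, of 0] by blast
  have [measurable]: "s i \<in> borel_measurable M" for i by (rule borel_measurable_simple_function[OF s])
  have ints: "integrable M (s i)" for i
    by (rule Bochner_Integration.integrable_bound[OF integrable_mult_right[OF integrable_norm[OF f], of 2]])
       (use bound in \<open>auto intro!: AE_I2\<close>)
  have "(\<lambda>i. \<integral>\<omega>. norm (s i \<omega> - f \<omega>) \<partial>M) \<longlonglongrightarrow> (\<integral>\<omega>. 0 \<partial>M)"
  proof (rule integral_dominated_convergence[where w="\<lambda>x. 3 * norm (f x)"])
    show "AE x in M. (\<lambda>i. norm (s i x - f x)) \<longlonglongrightarrow> 0"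
      using lim by (auto intro!: AE_I2 tendsto_norm_zero simp: LIM_zero)
    show "AE x in M. norm (norm (s i x - f x)) \<le> 3 * norm (f x)" for i
    proof (rule AE_I2)
      fix x assume "x \<in> space M"
      then show "norm (norm (s i x - f x)) \<le> 3 * norm (f x)"
        using bound[of x i] norm_triangle_ineq4[of "s i x" "f x"] by simp
    qed
  qed (use f in auto)
  then have small: "eventually (\<lambda>i. (\<integral>\<omega>. norm (s i \<omega> - f \<omega>) \<partial>M) < (1/2)^k) sequentially" for k
    by (intro order_tendstoD(2)) auto
  have "\<exists>i\<ge>k. (\<integral>\<omega>. norm (s i \<omega> - f \<omega>) \<partial>M) < (1/2)^k" for k
    using eventually_happens'[OF _ eventually_conj[OF small[of k] eventually_ge_at_top[of k]]] by auto
  then obtain r where r: "\<And>k. r k \<ge> k" "\<And>k. (\<integral>\<omega>. norm (s (r k) \<omega> - f \<omega>) \<partial>M) < (1/2)^k" by metis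
  \<comment> \<open>telescoping differences of a fast subsequence\<close>
  define u where "u i = (case i of 0 \<Rightarrow> s (r 0) | Suc k \<Rightarrow> (\<lambda>\<omega>. s (r (Suc k)) \<omega> - s (r k) \<omega>))" for i
  have partial: "(\<Sum>i<Suc n. u i \<omega>) = s (r n) \<omega>" for n \<omega>
    by (induction n) (auto simp: u_def)
  show thesis
  proof (rule that)
    show "simple_function M (u i)" for i
      using s by (auto simp: u_def split: nat.split)
    have bd: "norm (\<integral>\<omega>. norm (u (Suc k) \<omega>) \<partial>M) \<le> 2 * (1/2)^k" for k
    proof -
      have "(\<integral>\<omega>. norm (u (Suc k) \<omega>) \<partial>M)
          \<le> (\<integral>\<omega>. norm (s (r (Suc k)) \<omega> - f \<omega>) + norm (s (r k) \<omega> - f \<omega>) \<partial>M)"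
      proof (rule integral_mono)
        show "norm (u (Suc k) \<omega>) \<le> norm (s (r (Suc k)) \<omega> - f \<omega>) + norm (s (r k) \<omega> - f \<omega>)" for \<omega>
          using norm_triangle_ineq4[of "s (r (Suc k)) \<omega> - f \<omega>" "s (r k) \<omega> - f \<omega>"] by (simp add: u_def)
      qed (use ints f in \<open>auto simp: u_def\<close>)
      also have "\<dots> = (\<integral>\<omega>. norm (s (r (Suc k)) \<omega> - f \<omega>) \<partial>M) + (\<integral>\<omega>. norm (s (r k) \<omega> - f \<omega>) \<partial>M)"
        using ints f by (intro Bochner_Integration.integral_add) auto
      also have "\<dots> \<le> (1/2)^Suc k + (1/2)^k" using r(2)[of k] r(2)[of "Suc k"] by linarith
      also have "\<dots> \<le> 2 * (1/2)^k" by simp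
      finally show ?thesis by simp
    qed
    have "summable (\<lambda>k. 2 * (1/2::real)^k)"
      by (intro summable_mult summable_geometric) simp
    then have "summable (\<lambda>k. \<integral>\<omega>. norm (u (Suc k) \<omega>) \<partial>M)"
      by (rule summable_comparison_test'[where N=0]) (rule bd)
    then show "summable (\<lambda>i. \<integral>\<omega>. norm (u i \<omega>) \<partial>M)"
      by (simp only: summable_Suc_iff[of "\<lambda>i. \<integral>\<omega>. norm (u i \<omega>) \<partial>M"])
    fix \<omega> assume "\<omega> \<in> space M"
    moreover have "filterlim r at_top sequentially"
      by (rule filterlim_at_top_mono[OF filterlim_ident]) (simp add: r(1))
    ultimately have "(\<lambda>n. s (r n) \<omega>) \<longlonglongrightarrow> f \<omega>"
      using filterlim_compose[OF lim] by blast
    then have "(\<lambda>n. \<Sum>i<Suc n. u i \<omega>) \<longlonglongrightarrow> f \<omega>" by (simp only: partial)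
    then show "(\<lambda>i. u i \<omega>) sums f \<omega>" unfolding sums_def by (rule LIMSEQ_imp_Suc)
  qed
qed

text \<open>By the contraction property the conditional expectations of the simple terms again form a series that converges
  absolutely in \<open>L\<^sup>1\<close>. Its sum has the right integrals over the sets of \<open>G\<close>, since integration may be
  interchanged with such a summation.\<close>

theorem cond_exp_exists:
  fixes f :: "'w \<Rightarrow> 'x::{banach, second_countable_topology}"
  assumes M: "finite_measure M" "subalgebra M G" and f: "integrable M f"
  obtains h where "has_cond_exp M G f h"
proof -
  interpret finite_measure M by fact
  obtain u where u: "\<And>i. simple_function M (u i)" and sum_u: "summable (\<lambda>i. \<integral>\<omega>. norm (u i \<omega>) \<partial>M)"
    and sums: "\<And>\<omega>. \<omega> \<in> space M \<Longrightarrow> (\<lambda>i. u i \<omega>) sums f \<omega>"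
    by (rule integrable_eq_series_simple[OF M(1) f]) blast
  obtain h where h: "\<And>i. has_cond_exp M G (u i) (h i)"
    and le: "\<And>i. (\<integral>\<omega>. norm (h i \<omega>) \<partial>M) \<le> (\<integral>\<omega>. norm (u i \<omega>) \<partial>M)"
    using has_cond_exp_simple[OF M u] by metis
  have iu: "integrable M (u i)" and ih: "integrable M (h i)" and hG[measurable]: "h i \<in> borel_measurable G" for i
    using h[of i] by (auto simp: has_cond_exp_def L1_def)
  have sum_h: "summable (\<lambda>i. \<integral>\<omega>. norm (h i \<omega>) \<partial>M)"
    by (rule summable_comparison_test'[OF sum_u, where N=0]) (use le in auto)
  \<comment> \<open>a series that converges in \<open>L\<^sup>1\<close> norm converges absolutely almost everywhere\<close>
  have AE_summable: "AE \<omega> in M. summable (\<lambda>i. norm (v i \<omega>))"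
    if v: "\<And>i. integrable M (v i)" "summable (\<lambda>i. \<integral>\<omega>. norm (v i \<omega>) \<partial>M)" for v :: "nat \<Rightarrow> 'w \<Rightarrow> 'x"
  proof -
    have "(\<integral>\<^sup>+\<omega>. (\<Sum>i. ennreal (norm (v i \<omega>))) \<partial>M) = (\<Sum>i. \<integral>\<^sup>+\<omega>. ennreal (norm (v i \<omega>)) \<partial>M)"
      using v(1) by (intro nn_integral_suminf) auto
    also have "\<dots> = (\<Sum>i. ennreal (\<integral>\<omega>. norm (v i \<omega>) \<partial>M))"
      using v(1) by (intro suminf_cong nn_integral_eq_integral) auto
    also have "\<dots> \<noteq> \<infinity>"
      using v(2) by (simp add: ennreal_suminf_neq_top)
    finally have "AE \<omega> in M. (\<Sum>i. ennreal (norm (v i \<omega>))) \<noteq> \<infinity>"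
      using v(1) by (intro nn_integral_PInf_AE) auto
    then show ?thesis
      by (rule AE_mp) (auto intro!: AE_I2 summable_suminf_not_top)
  qed
  have set_sums: "(\<lambda>i. set_lebesgue_integral M A (v i)) sums set_lebesgue_integral M A (\<lambda>\<omega>. \<Sum>i. v i \<omega>)"
    if v: "\<And>i. integrable M (v i)" "summable (\<lambda>i. \<integral>\<omega>. norm (v i \<omega>) \<partial>M)" and A: "A \<in> sets M"
    for v :: "nat \<Rightarrow> 'w \<Rightarrow> 'x" and A
  proof -
    have "(\<lambda>i. \<integral>\<omega>. indicator A \<omega> *\<^sub>R v i \<omega> \<partial>M) sums (\<integral>\<omega>. (\<Sum>i. indicator A \<omega> *\<^sub>R v i \<omega>) \<partial>M)"
    proof (rule sums_integral)
      show "AE \<omega> in M. summable (\<lambda>i. norm (indicator A \<omega> *\<^sub>R v i \<omega>))"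
        using AE_summable[OF v] by eventually_elim (auto simp: indicator_def)
      show "summable (\<lambda>i. \<integral>\<omega>. norm (indicator A \<omega> *\<^sub>R v i \<omega>) \<partial>M)"
      proof (rule summable_comparison_test'[OF v(2), where N=0])
        show "norm (\<integral>\<omega>. norm (indicator A \<omega> *\<^sub>R v n \<omega>) \<partial>M) \<le> (\<integral>\<omega>. norm (v n \<omega>) \<partial>M)" for n
          using integral_mono[OF integrable_norm[OF integrable_mult_indicator[OF A v(1)[of n]]]
              integrable_norm[OF v(1)[of n]]] by (simp add: indicator_def)
      qed
    qed (use v A in \<open>auto intro: integrable_mult_indicator\<close>)
    moreover have "(\<Sum>i. indicator A \<omega> *\<^sub>R v i \<omega>) = indicator A \<omega> *\<^sub>R (\<Sum>i. v i \<omega>)" for \<omega>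
      by (simp add: indicator_def)
    ultimately show ?thesis by (simp add: set_lebesgue_integral_def)
  qed
  define H where "H \<omega> = (\<Sum>i. h i \<omega>)" for \<omega>
  have "H \<in> borel_measurable G" unfolding H_def by simp
  moreover have "integrable M H"
    unfolding H_def by (rule integrable_suminf[OF ih AE_summable[OF ih sum_h] sum_h])
  moreover have "set_lebesgue_integral M A H = set_lebesgue_integral M A f" if A: "A \<in> sets G" for A
  proof -
    have AM: "A \<in> sets M" using A M(2) by (auto simp: subalgebra_def)
    have "set_lebesgue_integral M A H = (\<Sum>i. set_lebesgue_integral M A (h i))"
      unfolding H_def using set_sums[OF ih sum_h AM] by (rule sums_unique)
    also have "\<dots> = (\<Sum>i. set_lebesgue_integral M A (u i))"
      using h A by (simp add: has_cond_exp_def)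
    also have "\<dots> = set_lebesgue_integral M A (\<lambda>\<omega>. \<Sum>i. u i \<omega>)"
      using set_sums[OF iu sum_u AM] by (rule sums_unique[symmetric])
    also have "\<dots> = set_lebesgue_integral M A f"
      unfolding set_lebesgue_integral_def
      by (intro Bochner_Integration.integral_cong) (auto dest!: sums sums_unique)
    finally show ?thesis .
  qed
  ultimately have "has_cond_exp M G f H" using f by (simp add: has_cond_exp_def L1_def)
  then show thesis by (rule that)
qed

section \<open>Predictable integrands on the product space\<close>

lemma norm_K_measurable:
  assumes F: "set_measurable G F"
  shows "(\<lambda>x. norm_K (F x)) \<in> borel_measurable G"
proof (rule borel_measurableI_greater)
  fix a :: ennreal
  have op: "open {x::'b. ennreal (norm x) > a}"
    by (intro open_Collect_less continuous_intros continuous_on_ennreal)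
  have "{x \<in> space G. a < norm_K (F x)} = {x \<in> space G. F x \<inter> {x. ennreal (norm x) > a} \<noteq> {}}"
    by (auto simp: norm_K_def less_SUP_iff)
  then show "{x \<in> space G. a < norm_K (F x)} \<in> sets G"
    using set_measurableD(3)[OF F op] by simp
qed

lemma norm_le_norm_K: "x \<in> A \<Longrightarrow> ennreal (norm x) \<le> norm_K A"
  unfolding norm_K_def by (rule SUP_upper)

locale poisson_setting = usual_filtered_prob_space M \<F>
  for M :: "'w measure" and \<F> :: "real \<Rightarrow> 'w measure" +
  fixes \<nu> :: "'z::{banach, second_countable_topology} measure"
    and p :: "'w \<Rightarrow> real \<rightharpoonup> 'z" and T :: real
  assumes sets_nu: "sets \<nu> = sets borel" and finite_nu: "finite_measure \<nu>"
    and T_pos: "T > 0"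
    and poisson: "stationary_poisson_point_process M \<F> \<nu> p"
begin

sublocale nu: finite_measure \<nu> by (rule finite_nu)
sublocale tz: pair_sigma_finite lborel \<nu> ..
sublocale W: pair_sigma_finite M "lborel \<Otimes>\<^sub>M \<nu>" ..

lemma space_nu [simp]: "space \<nu> = UNIV"
  using sets_eq_imp_space_eq[OF sets_nu] by simp

lemma space_F: "t \<ge> 0 \<Longrightarrow> space (\<F> t) = space M"
  using subalg unfolding subalgebra_def by auto

lemma sets_F_subset: "t \<ge> 0 \<Longrightarrow> A \<in> sets (\<F> t) \<Longrightarrow> A \<in> sets M"
  using subalg unfolding subalgebra_def by auto

lemma measurable_F_M: "t \<ge> 0 \<Longrightarrow> f \<in> measurable (\<F> t) N \<Longrightarrow> f \<in> measurable M N"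
  using subalg measurable_from_subalg by blast

text \<open>For Fubini's theorem it is convenient to have \<open>\<omega>\<close> as the outer coordinate, whereas integrands take the arguments
  in the order \<open>(t, z, \<omega>)\<close>; \<open>cyc\<close> translates between the two. Predictable functions live
  on \<open>strip\<close> only and have no meaning outside, hence the default values below.\<close>

abbreviation W :: "('w \<times> real \<times> 'z) measure" where
  "W \<equiv> M \<Otimes>\<^sub>M (lborel \<Otimes>\<^sub>M \<nu>)"

abbreviation cyc :: "'w \<times> real \<times> 'z \<Rightarrow> real \<times> 'z \<times> 'w" where
  "cyc \<equiv> (\<lambda>(\<omega>, t, z). (t, z, \<omega>))"

abbreviation "strip \<equiv> space M \<times> ({0..T} \<times> (UNIV :: 'z set))"

lemma sets_strip: "S \<in> sets borel \<Longrightarrow> A \<in> sets M \<Longrightarrow> A \<times> (S \<times> UNIV) \<in> sets W"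
  using sets.top[of \<nu>] by (intro pair_measureI) auto

lemma space_W: "space W = space M \<times> UNIV"
  by (simp add: space_pair_measure)

text \<open>It suffices to treat a generator \<open>g\<close>. By left continuity \<open>g(t, z, \<omega>)\<close> is the limit of \<open>g(\<tau>\<^sub>n(t), z, \<omega>)\<close>, where \<open>\<tau>\<^sub>n(t)\<close>
  is the last grid point strictly before \<open>t\<close> (for \<open>t > 0\<close>; the value at \<open>t = 0\<close> is kept). As \<open>\<tau>\<^sub>n\<close> has countably many values, each of the approximants is
  measurable.\<close>

lemma predictable_jointly_measurable:
  "cyc \<in> measurable (restrict_space W strip)
     (predictable_sigma TYPE('x::{banach, second_countable_topology}) M \<F> T)"
  unfolding predictable_sigma_def
proof (rule measurable_measure_of, goal_cases)
  case 1 show ?case by auto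
next
  case 2 show ?case by (auto simp: space_restrict_space space_W)
next
  case (3 y)
  then obtain g :: "real \<times> 'z \<times> 'w \<Rightarrow> 'x" and B where g: "g \<in> predictable_generators \<F> T"
    and B: "B \<in> sets borel" and y: "y = g -` B \<inter> ({0..T} \<times> UNIV \<times> space M)"
    by auto
  let ?E = "restrict_space W strip"
  have spE: "space ?E = strip" by (auto simp: space_restrict_space space_W)
  \<comment> \<open>the ceiling minus one, not the floor, because \<open>\<tau> n t\<close> has to be strictly less than \<open>t\<close> at grid points as well;
    truncation at \<open>0\<close> gives \<open>\<tau> n 0 = 0\<close>\<close>
  define k where "k n t = nat (\<lceil>real (Suc n) * t\<rceil> - 1)" for n and t :: real
  define \<tau> where "\<tau> n t = real (k n t) / real (Suc n)" for n t
  have \<tau>_less: "\<tau> n t < t" and \<tau>_ge: "t - 1 / real (Suc n) \<le> \<tau> n t" if "t > 0" for n t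
  proof -
    have "real (Suc n) * t > 0" using that by (intro mult_pos_pos) auto
    then have "\<lceil>real (Suc n) * t\<rceil> \<ge> 1" by (simp add: one_le_ceiling)
    then have k: "real (k n t) = real_of_int \<lceil>real (Suc n) * t\<rceil> - 1" by (simp add: k_def)
    have "real (k n t) < real (Suc n) * t" unfolding k by linarith
    then show "\<tau> n t < t" by (simp add: \<tau>_def divide_less_eq mult.commute)
    have "real (Suc n) * t - 1 \<le> real (k n t)" unfolding k by linarith
    then have "(real (Suc n) * t - 1) / real (Suc n) \<le> \<tau> n t"
      unfolding \<tau>_def by (intro divide_right_mono) auto
    then show "t - 1 / real (Suc n) \<le> \<tau> n t" by (simp add: diff_divide_distrib)
  qed
  have \<tau>0: "\<tau> n 0 = 0" for n by (simp add: \<tau>_def k_def)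
  have \<tau>_nonneg: "0 \<le> \<tau> n t" for n t by (simp add: \<tau>_def)
  have \<tau>_T: "\<tau> n t \<le> T" if "t \<in> {0..T}" for n t
    using \<tau>_less[of t n] \<tau>0 that by (cases "t = 0") (auto simp: not_le)
  define G where "G n = (\<lambda>(\<omega>, t, z). g (\<tau> n t, z, \<omega>))" for n
  have G: "G n \<in> borel_measurable ?E" for n
  proof -
    have g_meas: "(\<lambda>(\<omega>, t, z). if real i / real (Suc n) \<le> T then g (real i / real (Suc n), z, \<omega>) else 0)
        \<in> borel_measurable W" for i :: nat
    proof (cases "real i / real (Suc n) \<le> T")
      case True
      let ?s = "real i / real (Suc n)"
      have "(\<lambda>(z, \<omega>). g (?s, z, \<omega>)) \<in> borel_measurable (borel \<Otimes>\<^sub>M \<F> ?s)"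
        using g True by (auto simp: predictable_generators_def)
      moreover have "(\<lambda>(\<omega>, t, z). (z, \<omega>)) \<in> measurable W (borel \<Otimes>\<^sub>M \<F> ?s)"
      proof -
        have "(\<lambda>w. snd (snd w)) \<in> measurable W borel"
          using measurable_compose[OF measurable_snd measurable_snd] measurable_cong_sets[OF refl sets_nu] by blast
        moreover have "fst \<in> measurable W (\<F> ?s)"
          by (rule measurable_compose[OF measurable_fst])
             (use measurable_F_M[OF _ measurable_ident, of ?s] in \<open>auto simp: id_def\<close>)
        ultimately have "(\<lambda>w. (snd (snd w), fst w)) \<in> measurable W (borel \<Otimes>\<^sub>M \<F> ?s)"
          by (rule measurable_Pair)
        then show ?thesis by (simp add: case_prod_beta')
      qed
      ultimately have "(\<lambda>w. (\<lambda>(z, \<omega>). g (?s, z, \<omega>)) ((\<lambda>(\<omega>, t, z). (z, \<omega>)) w)) \<in> borel_measurable W"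
        by (rule measurable_compose[rotated])
      then show ?thesis using True by (simp add: case_prod_beta')
    qed (simp add: case_prod_beta')
    have "(\<lambda>w. k n (fst (snd w))) \<in> measurable W (count_space UNIV)"
      unfolding k_def by measurable
    then have "(\<lambda>w. (\<lambda>(\<omega>, t, z). if real (k n (fst (snd w))) / real (Suc n) \<le> T
        then g (real (k n (fst (snd w))) / real (Suc n), z, \<omega>) else 0) w) \<in> borel_measurable W"
      by (rule measurable_compose_countable[OF g_meas])
    then have "(\<lambda>(\<omega>, t, z). if \<tau> n t \<le> T then g (\<tau> n t, z, \<omega>) else 0) \<in> borel_measurable W"
      unfolding \<tau>_def case_prod_beta' by simp
    then have "(\<lambda>(\<omega>, t, z). if \<tau> n t \<le> T then g (\<tau> n t, z, \<omega>) else 0) \<in> borel_measurable ?E"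
      by (rule measurable_restrict_space1)
    then show ?thesis
      by (rule measurable_cong[THEN iffD1, rotated]) (auto simp: spE G_def \<tau>_T)
  qed
  have "(\<lambda>w. g (cyc w)) \<in> borel_measurable ?E"
  proof (rule borel_measurable_LIMSEQ_metric[OF G])
    fix w assume "w \<in> space ?E"
    then obtain \<omega> t z where w: "w = (\<omega>, t, z)" "\<omega> \<in> space M" "t \<in> {0..T}" by (auto simp: spE)
    show "(\<lambda>n. G n w) \<longlonglongrightarrow> g (cyc w)"
    proof (cases "t = 0")
      case False
      then have t: "t > 0" using w by auto
      have "continuous (at_left t) (\<lambda>s. g (s, z, \<omega>))"
        using g w t by (auto simp: predictable_generators_def space_F)
      then have lim: "((\<lambda>s. g (s, z, \<omega>)) \<longlongrightarrow> g (t, z, \<omega>)) (at_left t)" by (simp add: continuous_within)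
      have "(\<lambda>n. t - 1 / real (Suc n)) \<longlonglongrightarrow> t - 0"
        by (rule tendsto_diff[OF tendsto_const LIMSEQ_inverse_real_of_nat[unfolded inverse_eq_divide]])
      then have lower: "(\<lambda>n. t - 1 / real (Suc n)) \<longlonglongrightarrow> t" by (simp only: diff_0_right)
      have "(\<lambda>n. \<tau> n t) \<longlonglongrightarrow> t"
        by (rule tendsto_sandwich[OF _ _ lower tendsto_const];
            rule always_eventually; intro allI less_imp_le[OF \<tau>_less[OF t]] \<tau>_ge[OF t])
      then have "filterlim (\<lambda>n. \<tau> n t) (at_left t) sequentially"
        using \<tau>_less[OF t] by (auto simp: filterlim_at less_imp_neq)
      from filterlim_compose[OF lim this] show ?thesis by (simp add: w G_def)
    qed (simp add: w G_def \<tau>0)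
  qed
  then have "(\<lambda>w. g (cyc w)) -` B \<inter> space ?E \<in> sets ?E" using B by (rule measurable_sets)
  also have "(\<lambda>w. g (cyc w)) -` B \<inter> space ?E = cyc -` y \<inter> space ?E"
    by (auto simp: y spE)
  finally show ?case .
qed

lemma space_predictable: "space (predictable_sigma X M \<F> T) = {0..T} \<times> UNIV \<times> space M"
  unfolding predictable_sigma_def by (rule space_measure_of) auto

lemma predictable_extend_measurable:
  fixes u :: "real \<times> 'z \<times> 'w \<Rightarrow> 'b"
  assumes "u \<in> measurable (predictable_sigma TYPE('x::{banach, second_countable_topology}) M \<F> T) N"
    and "c \<in> space N"
  shows "(\<lambda>w. if w \<in> strip then u (cyc w) else c) \<in> measurable W N"
proof -
  have "(\<lambda>w. u (cyc w)) \<in> measurable (restrict_space W strip) N"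
    by (rule measurable_compose[OF predictable_jointly_measurable assms(1)])
  moreover have "strip \<inter> space W \<in> sets W"
    using sets_strip[of "{0..T}" "space M"] by auto
  ultimately show ?thesis
    using assms(2) by (simp add: measurable_restrict_space_iff)
qed

text \<open>The exceptional set in the definition of a selection is null for the product taken in the order \<open>(t, (z, \<omega>))\<close>;
  by Tonelli's theorem the order is immaterial.\<close>

lemma AE_selection_W:
  assumes "AE x in restrict_space lborel {0..T} \<Otimes>\<^sub>M (\<nu> \<Otimes>\<^sub>M M). R x"
  shows "AE w in W. w \<in> strip \<longrightarrow> R (cyc w)"
proof -
  let ?Q = "restrict_space lborel {0..T} \<Otimes>\<^sub>M (\<nu> \<Otimes>\<^sub>M M)"
  interpret zw: pair_sigma_finite \<nu> M ..
  interpret R: sigma_finite_measure "restrict_space lborel {0..T} :: real measure"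
    by (rule sigma_finite_measure_restrict_space) (auto intro: sigma_finite_lborel)
  interpret Q: pair_sigma_finite "restrict_space lborel {0..T} :: real measure" "\<nu> \<Otimes>\<^sub>M M" ..
  obtain N where N: "N \<in> sets ?Q" "emeasure ?Q N = 0" "{x\<in>space ?Q. \<not> R x} \<subseteq> N"
    using assms unfolding eventually_ae_filter by auto
  then have "AE x in ?Q. x \<notin> N" by (intro AE_not_in) auto
  then have "AE t in restrict_space lborel {0..T}. AE y in \<nu> \<Otimes>\<^sub>M M. (t, y) \<notin> N"
    by (rule Q.AE_pair)
  then have AE_N: "AE t in lborel. t \<in> {0..T} \<longrightarrow> (AE z in \<nu>. AE \<omega> in M. (t, z, \<omega>) \<notin> N)"
    by (subst (asm) AE_restrict_space_iff) (auto elim!: eventually_mono dest: zw.AE_pair)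
  define N' where "N' = {w \<in> space W. w \<in> strip \<and> cyc w \<in> N}"
  have "cyc \<in> measurable (restrict_space W strip) ?Q"
  proof -
    have "fst \<circ> snd \<in> measurable (restrict_space W strip) (restrict_space lborel {0..T})"
      by (rule measurable_restrict_space3) (auto simp: o_def)
    moreover have "(\<lambda>w. (snd (snd w), fst w)) \<in> measurable (restrict_space W strip) (\<nu> \<Otimes>\<^sub>M M)"
      by (rule measurable_restrict_space1) simp
    ultimately have "(\<lambda>w. ((fst \<circ> snd) w, (snd (snd w), fst w))) \<in> measurable (restrict_space W strip) ?Q"
      by (rule measurable_Pair)
    then show ?thesis by (simp add: case_prod_beta')
  qed
  then have "cyc -` N \<inter> space (restrict_space W strip) \<in> sets (restrict_space W strip)"
    using N(1) by (rule measurable_sets)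
  moreover have "cyc -` N \<inter> space (restrict_space W strip) = N'"
    by (auto simp: N'_def space_restrict_space)
  ultimately have N'[measurable]: "N' \<in> sets W"
    using sets_strip[of "{0..T}" "space M"] by (auto simp: sets_restrict_space_iff)
  have "emeasure W N' = integral\<^sup>N W (indicator N')" using N' by (rule nn_integral_indicator[symmetric])
  also have "\<dots> = (\<integral>\<^sup>+y. \<integral>\<^sup>+\<omega>. indicator N' (\<omega>, y) \<partial>M \<partial>(lborel \<Otimes>\<^sub>M \<nu>))"
    by (rule W.nn_integral_snd[symmetric]) simp
  also have "\<dots> = (\<integral>\<^sup>+t. \<integral>\<^sup>+z. \<integral>\<^sup>+\<omega>. indicator N' (\<omega>, t, z) \<partial>M \<partial>\<nu> \<partial>lborel)"
    by (subst nu.nn_integral_fst[symmetric]) auto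
  also have "\<dots> = (\<integral>\<^sup>+(t::real). 0 \<partial>lborel)"
  proof (rule nn_integral_cong_AE)
    show "AE t in lborel. (\<integral>\<^sup>+z. \<integral>\<^sup>+\<omega>. indicator N' (\<omega>, t, z) \<partial>M \<partial>\<nu>) = 0"
    using AE_N proof (rule eventually_mono)
    fix t :: real assume t: "t \<in> {0..T} \<longrightarrow> (AE z in \<nu>. AE \<omega> in M. (t, z, \<omega>) \<notin> N)"
    have "(\<integral>\<^sup>+z. \<integral>\<^sup>+\<omega>. indicator N' (\<omega>, t, z) \<partial>M \<partial>\<nu>) = (\<integral>\<^sup>+z. \<integral>\<^sup>+\<omega>. 0 \<partial>M \<partial>\<nu>)"
    proof (cases "t \<in> {0..T}")
      case True
      with t have "AE z in \<nu>. AE \<omega> in M. (t, z, \<omega>) \<notin> N" by simp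
      then show ?thesis
        by (intro nn_integral_cong_AE, eventually_elim)
           (intro nn_integral_cong_AE, auto elim!: eventually_mono simp: N'_def)
    qed (auto simp: N'_def)
    then show "(\<integral>\<^sup>+z. \<integral>\<^sup>+\<omega>. indicator N' (\<omega>, t, z) \<partial>M \<partial>\<nu>) = 0" by simp
  qed
  qed
  finally have "N' \<in> null_sets W" using N' by (simp add: null_sets_def)
  then have "AE w in W. w \<notin> N'" by (rule AE_not_in)
  then show ?thesis
    by (rule AE_mp) (use N(3) in \<open>auto intro!: AE_I2 simp: N'_def space_pair_measure space_restrict_space\<close>)
qed

end

section \<open>Decomposable hulls\<close>

text \<open>Refine the partition of \<open>\<eta>\<close> by removing \<open>B\<close> from each of its members, and add \<open>B\<close> as a last member.\<close>

lemma decomposable_hull_paste: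
  assumes B: "B \<in> sets G" and g: "g \<in> \<Gamma>" and \<eta>: "\<eta> \<in> decomposable_hull G \<Gamma>"
  shows "(\<lambda>\<omega>. indicator B \<omega> *\<^sub>R g \<omega> + indicator (space G - B) \<omega> *\<^sub>R \<eta> \<omega>) \<in> decomposable_hull G \<Gamma>"
proof -
  obtain m A h where \<eta>_eq: "\<eta> = (\<lambda>\<omega>. \<Sum>i<m. indicator (A i) \<omega> *\<^sub>R h i \<omega>)"
    and A: "A ` {..<m::nat} \<subseteq> sets G" "disjoint_family_on A {..<m}" "(\<Union>i<m. A i) = space G"
    and h: "h ` {..<m} \<subseteq> \<Gamma>"
    using \<eta> by (auto simp: decomposable_hull_def)
  define A' where "A' i = (if i < m then A i - B else B)" for i
  define h' where "h' i = (if i < m then h i else g)" for i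
  have "A' ` {..<Suc m} \<subseteq> sets G" using A(1) B by (auto simp: A'_def)
  moreover have "disjoint_family_on A' {..<Suc m}"
    using A(2) by (auto simp: disjoint_family_on_def A'_def)
  moreover have "(\<Union>i<Suc m. A' i) = space G"
    using A(3) sets.sets_into_space[OF B] by (auto simp: A'_def lessThan_Suc split: if_splits)
  moreover have "h' ` {..<Suc m} \<subseteq> \<Gamma>" using h g by (auto simp: h'_def)
  moreover have "(\<lambda>\<omega>. indicator B \<omega> *\<^sub>R g \<omega> + indicator (space G - B) \<omega> *\<^sub>R \<eta> \<omega>)
      = (\<lambda>\<omega>. \<Sum>i<Suc m. indicator (A' i) \<omega> *\<^sub>R h' i \<omega>)"
  proof
    fix \<omega>
    have "indicator (space G - B) \<omega> *\<^sub>R indicator (A i) \<omega> *\<^sub>R h i \<omega> = indicator (A' i) \<omega> *\<^sub>R h' i \<omega>"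
      if "i < m" for i
      using that A(3) by (auto simp: indicator_def A'_def h'_def)
    then have "indicator (space G - B) \<omega> *\<^sub>R \<eta> \<omega> = (\<Sum>i<m. indicator (A' i) \<omega> *\<^sub>R h' i \<omega>)"
      by (simp only: \<eta>_eq scaleR_sum_right) (intro sum.cong, auto)
    then show "indicator B \<omega> *\<^sub>R g \<omega> + indicator (space G - B) \<omega> *\<^sub>R \<eta> \<omega>
      = (\<Sum>i<Suc m. indicator (A' i) \<omega> *\<^sub>R h' i \<omega>)"
      by (simp add: A'_def h'_def)
  qed
  ultimately show ?thesis
    unfolding decomposable_hull_def mem_Collect_eq
    by (intro exI[of _ "Suc m"] exI[of _ A'] exI[of _ h'] conjI) (assumption | simp)+
qed

text \<open>If \<open>f\<close> is not integrable, its Bochner integral is \<open>0\<close> by convention and the bound is trivial. So the estimate can be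
  used path by path.\<close>

lemma norm_integral_le_nn_integral:
  fixes f :: "'a \<Rightarrow> 'b::{banach, second_countable_topology}"
  shows "ennreal (norm (integral\<^sup>L N f)) \<le> (\<integral>\<^sup>+x. ennreal (norm (f x)) \<partial>N)"
  by (cases "integrable N f") (simp_all add: integral_norm_bound_ennreal not_integrable_integral_eq)

section \<open>The event that there are no jumps\<close>

context poisson_setting
begin

abbreviation slab :: "real \<Rightarrow> (real \<times> 'z) set" where "slab s \<equiv> {0<..s} \<times> UNIV"

lemma sets_slab [measurable]: "slab s \<in> sets (lborel \<Otimes>\<^sub>M \<nu>)"
  using sets.top[of \<nu>] by (intro pair_measureI) auto

lemma emeasure_slab: "s \<ge> 0 \<Longrightarrow> emeasure (lborel \<Otimes>\<^sub>M \<nu>) (slab s) = ennreal (s * measure \<nu> UNIV)"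
  using sets.top[of \<nu>] by (subst nu.emeasure_pair_measure_Times)
    (auto simp: nu.emeasure_eq_measure ennreal_mult)

definition no_jump :: "real \<Rightarrow> 'w set" where
  "no_jump s = {\<omega> \<in> space M. emeasure (counting_measure (p \<omega>)) (slab s) = 0}"

lemma sets_no_jump: assumes "s \<ge> 0" shows "no_jump s \<in> sets (\<F> s)"
proof -
  have "(\<lambda>\<omega>. emeasure (counting_measure (p \<omega>)) (slab s)) \<in> borel_measurable (\<F> s)"
    using poisson assms unfolding stationary_poisson_point_process_def Let_def by auto
  then have "(\<lambda>\<omega>. emeasure (counting_measure (p \<omega>)) (slab s)) -` {0} \<inter> space (\<F> s) \<in> sets (\<F> s)"
    by (rule measurable_sets) simp
  moreover have "(\<lambda>\<omega>. emeasure (counting_measure (p \<omega>)) (slab s)) -` {0} \<inter> space (\<F> s) = no_jump s"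
    by (auto simp: no_jump_def space_F[OF assms])
  ultimately show ?thesis by simp
qed

lemma events_no_jump: "s \<ge> 0 \<Longrightarrow> no_jump s \<in> events"
  using sets_F_subset sets_no_jump by blast

lemma prob_no_jump: assumes "s > 0" shows "prob (no_jump s) = exp (- (s * measure \<nu> UNIV))"
proof -
  let ?\<A> = "{A \<in> sets (borel \<Otimes>\<^sub>M borel). A \<subseteq> {0<..} \<times> (UNIV :: 'z set)}"
  have "\<forall>A\<in>?\<A>. emeasure (lborel \<Otimes>\<^sub>M \<nu>) A < \<infinity> \<longrightarrow>
     (\<forall>n::nat. prob {\<omega>\<in>space M. emeasure (counting_measure (p \<omega>)) A = of_nat n}
       = measure (lborel \<Otimes>\<^sub>M \<nu>) A ^ n / fact n * exp (- measure (lborel \<Otimes>\<^sub>M \<nu>) A))"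
    using poisson unfolding stationary_poisson_point_process_def Let_def by blast
  moreover have "slab s \<in> ?\<A>" by auto
  moreover have "emeasure (lborel \<Otimes>\<^sub>M \<nu>) (slab s) < \<infinity>"
    using emeasure_slab[of s] assms by simp
  ultimately have "\<forall>n::nat. prob {\<omega>\<in>space M. emeasure (counting_measure (p \<omega>)) (slab s) = of_nat n}
       = measure (lborel \<Otimes>\<^sub>M \<nu>) (slab s) ^ n / fact n * exp (- measure (lborel \<Otimes>\<^sub>M \<nu>) (slab s))"
    by blast
  from this[rule_format, of 0] show ?thesis
    using emeasure_slab[of s] assms by (simp add: no_jump_def measure_def)
qed

lemma no_jump_antimono: "s \<le> t \<Longrightarrow> no_jump t \<subseteq> no_jump s"
proof
  assume "s \<le> t"
  then have "emeasure (counting_measure (p \<omega>)) (slab s) \<le> emeasure (counting_measure (p \<omega>)) (slab t)" for \<omega>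
    by (intro emeasure_mono) (auto simp: counting_measure_def)
  then show "\<omega> \<in> no_jump t \<Longrightarrow> \<omega> \<in> no_jump s" for \<omega>
    by (auto simp: no_jump_def) (metis le_zero_eq)
qed

definition small_time :: "nat \<Rightarrow> real" where "small_time n = T / real (Suc n)"

lemma small_time: "0 < small_time n" "small_time n \<le> T" "small_time (Suc n) \<le> small_time n"
  using T_pos by (auto simp: small_time_def divide_simps)

lemma small_time_tendsto: "small_time \<longlonglongrightarrow> 0"
  using tendsto_mult[OF tendsto_const[of T] LIMSEQ_inverse_real_of_nat]
  by (simp add: small_time_def[abs_def] field_simps)

text \<open>The events \<open>no_jump s\<close> grow as \<open>s\<close> decreases to \<open>0\<close>, and their probability \<open>exp (- s \<nu>(Z))\<close> tends to \<open>1\<close>.\<close>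

lemma AE_eventually_no_jump: "AE \<omega> in M. eventually (\<lambda>n. \<omega> \<in> no_jump (small_time n)) sequentially"
proof -
  let ?B = "\<lambda>n. no_jump (small_time n)"
  have ev: "range ?B \<subseteq> events" using events_no_jump small_time(1) by (auto intro: less_imp_le)
  have inc: "incseq ?B" by (intro incseq_SucI no_jump_antimono small_time(3))
  have "(\<lambda>n. prob (?B n)) \<longlonglongrightarrow> prob (\<Union>n. ?B n)"
    by (rule finite_Lim_measure_incseq[OF ev inc])
  moreover have "(\<lambda>n. exp (- (small_time n * measure \<nu> UNIV))) \<longlonglongrightarrow> exp (- (0 * measure \<nu> UNIV))"
    by (intro tendsto_intros small_time_tendsto)
  ultimately have "prob (\<Union>n. ?B n) = 1"
    using LIMSEQ_unique by (simp add: prob_no_jump small_time)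
  then have "AE \<omega> in M. \<omega> \<in> (\<Union>n. ?B n)" using ev by (subst (asm) prob_eq_1) auto
  then show ?thesis
  proof (rule eventually_mono)
    fix \<omega> assume "\<omega> \<in> (\<Union>n. ?B n)"
    then obtain n where "\<omega> \<in> ?B n" by auto
    then have "\<omega> \<in> ?B k" if "k \<ge> n" for k using incseqD[OF inc that] by auto
    then show "eventually (\<lambda>n. \<omega> \<in> ?B n) sequentially" by (auto simp: eventually_sequentially)
  qed
qed

lemma compensated_integral_no_jump:
  assumes "\<omega> \<in> no_jump s"
  shows "compensated_integral \<nu> p f s \<omega> = - (LINT y|(lborel \<Otimes>\<^sub>M \<nu>). indicator (slab s) y *\<^sub>R f (cyc (\<omega>, y)))"
proof -
  let ?N = "counting_measure (p \<omega>)"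
  have "slab s \<in> null_sets ?N"
    using assms by (auto simp: no_jump_def null_sets_def counting_measure_def)
  then have "AE y in ?N. indicator (slab s) y *\<^sub>R f (cyc (\<omega>, y)) = 0"
    using AE_not_in[of "slab s" ?N] by (auto elim!: eventually_mono simp: indicator_def)
  then have "(LINT y|?N. indicator (slab s) y *\<^sub>R f (cyc (\<omega>, y))) = 0"
    by (rule integral_eq_zero_AE)
  then show ?thesis
    by (simp add: compensated_integral_def set_lebesgue_integral_def case_prod_beta')
qed

text \<open>The expectation of \<open>\<integral>\<^sub>0\<^sup>s \<integral> \<parallel>F\<parallel> d\<nu> dr\<close>, which dominates the norms of the integrals of all selections on
  \<open>no_jump s\<close>.\<close>

definition mean_norm :: "(real \<times> 'z \<times> 'w \<Rightarrow> 'x::{banach, second_countable_topology} set) \<Rightarrow> real \<Rightarrow> ennreal" where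
  "mean_norm F s = (\<integral>\<^sup>+w. indicator (space M \<times> slab s) w * norm_K (F (cyc w)) \<partial>W)"

lemma sets_cylinder: "A \<in> events \<Longrightarrow> A \<times> slab s \<in> sets W"
  by (rule sets_strip) auto

lemma measurable_norm_K_W:
  assumes "F \<in> \<M>_space M \<F> \<nu> T"
  shows "(\<lambda>w. if w \<in> strip then norm_K (F (cyc w)) else 0) \<in> borel_measurable W"
  using assms unfolding \<M>_space_def
  by (intro predictable_extend_measurable norm_K_measurable) auto

lemma indicator_strip:
  fixes g :: "'w \<times> real \<times> 'z \<Rightarrow> 'b::real_vector"
  assumes "s \<le> T" "A \<subseteq> space M"
  shows "(\<lambda>w. indicator (A \<times> slab s) w * (k w :: ennreal))
      = (\<lambda>w. indicator (A \<times> slab s) w * (if w \<in> strip then k w else 0))"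
    and "(\<lambda>w. indicator (A \<times> slab s) w *\<^sub>R g w)
      = (\<lambda>w. indicator (A \<times> slab s) w *\<^sub>R (if w \<in> strip then g w else 0))"
  using assms by (auto simp: indicator_def fun_eq_iff)

lemma measurable_mean_norm:
  assumes "F \<in> \<M>_space M \<F> \<nu> T" "s \<le> T"
  shows "(\<lambda>w. indicator (space M \<times> slab s) w * norm_K (F (cyc w))) \<in> borel_measurable W"
  using sets_cylinder[OF sets.top, of s] measurable_norm_K_W[OF assms(1)]
  by (subst indicator_strip(1)[OF assms(2) order_refl])
     (intro borel_measurable_times_ennreal borel_measurable_indicator)

text \<open>Compare with the second moment of \<open>F\<close> by \<open>a \<le> 1 + a\<^sup>2\<close>; the constant is integrable as the intensity measure of
  \<open>(0, T] \<times> Z\<close> is finite.\<close>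

lemma mean_norm_finite:
  assumes F: "F \<in> \<M>_space M \<F> \<nu> T"
  shows "mean_norm F T < \<infinity>"
proof -
  let ?k = "\<lambda>w. if w \<in> strip then norm_K (F (cyc w)) else 0"
  note [measurable] = measurable_norm_K_W[OF F]
  note cyl = sets_cylinder[OF sets.top, of T]
  have k2: "(\<lambda>w. (?k w)\<^sup>2) \<in> borel_measurable W" by measurable
  have "(\<integral>\<^sup>+w. (?k w)\<^sup>2 \<partial>W) = (\<integral>\<^sup>+\<omega>. \<integral>\<^sup>+y. (?k (\<omega>, y))\<^sup>2 \<partial>(lborel \<Otimes>\<^sub>M \<nu>) \<partial>M)"
    by (rule tz.P.nn_integral_fst[symmetric, OF k2])
  also have "\<dots> = (\<integral>\<^sup>+\<omega>. \<integral>\<^sup>+t. \<integral>\<^sup>+z. (?k (\<omega>, t, z))\<^sup>2 \<partial>\<nu> \<partial>lborel \<partial>M)"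
    by (intro nn_integral_cong nu.nn_integral_fst[symmetric] measurable_compose_Pair1[OF _ k2])
  also have "\<dots> = (\<integral>\<^sup>+\<omega>. (\<integral>\<^sup>+t\<in>{0..T}. (\<integral>\<^sup>+z. (norm_K (F (t, z, \<omega>)))\<^sup>2 \<partial>\<nu>) \<partial>lborel) \<partial>M)"
    by (intro nn_integral_cong) (auto split: split_indicator)
  also have "\<dots> < \<infinity>" using F by (simp add: \<M>_space_def)
  finally have fin: "(\<integral>\<^sup>+w. (?k w)\<^sup>2 \<partial>W) < \<infinity>" .
  have le: "a \<le> 1 + a\<^sup>2" for a :: ennreal
  proof (cases "a \<le> 1")
    case False
    then have "a * 1 \<le> a * a" by (intro mult_left_mono) auto
    then show ?thesis by (simp add: power2_eq_square add_increasing)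
  qed (simp add: add_increasing2)
  have "mean_norm F T \<le> (\<integral>\<^sup>+w. indicator (space M \<times> slab T) w + (?k w)\<^sup>2 \<partial>W)"
    unfolding mean_norm_def using T_pos
    by (intro nn_integral_mono) (auto simp: indicator_def le)
  also have "\<dots> = emeasure W (space M \<times> slab T) + (\<integral>\<^sup>+w. (?k w)\<^sup>2 \<partial>W)"
    using nn_integral_add[OF borel_measurable_indicator[OF cyl] k2] nn_integral_indicator[OF cyl] by simp
  also have "emeasure W (space M \<times> slab T) = ennreal (T * measure \<nu> UNIV)"
    using emeasure_slab[of T] T_pos sets_slab[of T]
    by (simp add: tz.P.emeasure_pair_measure_Times emeasure_space_1)
  finally show ?thesis using fin by (auto simp: less_top[symmetric] top_unique)
qed

lemma mean_norm_tendsto: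
  assumes F: "F \<in> \<M>_space M \<F> \<nu> T"
  shows "(\<lambda>n. mean_norm F (small_time n)) \<longlonglongrightarrow> 0"
proof -
  have "(\<lambda>n. \<integral>\<^sup>+w. indicator (space M \<times> slab (small_time n)) w * norm_K (F (cyc w)) \<partial>W) \<longlonglongrightarrow> (\<integral>\<^sup>+w. 0 \<partial>W)"
  proof (rule nn_integral_dominated_convergence[where w="\<lambda>w. indicator (space M \<times> slab T) w * norm_K (F (cyc w))"])
    show "AE w in W. indicator (space M \<times> slab (small_time n)) w * norm_K (F (cyc w))
        \<le> indicator (space M \<times> slab T) w * norm_K (F (cyc w))" for n
      using small_time(2)[of n] by (intro AE_I2 mult_right_mono) (auto simp: indicator_def)
    show "(\<integral>\<^sup>+w. indicator (space M \<times> slab T) w * norm_K (F (cyc w)) \<partial>W) < \<infinity>"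
      using mean_norm_finite[OF F] by (simp add: mean_norm_def)
    show "AE w in W. (\<lambda>n. indicator (space M \<times> slab (small_time n)) w * norm_K (F (cyc w))) \<longlonglongrightarrow> 0"
    proof (rule AE_I2)
      fix w :: "'w \<times> real \<times> 'z"
      obtain \<omega> t z where w: "w = (\<omega>, t, z)" by (cases w)
      have "eventually (\<lambda>n. w \<notin> space M \<times> slab (small_time n)) sequentially"
      proof (cases "t > 0")
        case True
        show ?thesis
          by (rule eventually_mono[OF order_tendstoD(2)[OF small_time_tendsto True]]) (auto simp: w)
      qed (auto simp: w)
      then have "eventually (\<lambda>n. indicator (space M \<times> slab (small_time n)) w * norm_K (F (cyc w)) = 0) sequentially"
        by (rule eventually_mono) simp
      then show "(\<lambda>n. indicator (space M \<times> slab (small_time n)) w * norm_K (F (cyc w))) \<longlonglongrightarrow> 0"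
        by (rule tendsto_eventually)
    qed
  qed (use measurable_mean_norm[OF F] small_time(2) in auto)
  then show ?thesis by (simp add: mean_norm_def)
qed

lemma selection_AE:
  assumes "f \<in> selections M \<F> \<nu> T F"
  shows "AE w in W. w \<in> strip \<longrightarrow> f (cyc w) \<in> F (cyc w)"
  using assms unfolding selections_def by (intro AE_selection_W) auto

lemma selection_integrable:
  fixes F :: "real \<times> 'z \<times> 'w \<Rightarrow> 'x::{banach, second_countable_topology} set"
  assumes F: "F \<in> \<M>_space M \<F> \<nu> T" and f: "f \<in> selections M \<F> \<nu> T F"
    and A: "A \<in> events" and s: "s \<le> T"
  shows "integrable W (\<lambda>w. indicator (A \<times> slab s) w *\<^sub>R f (cyc w))"
proof (rule integrableI_bounded)
  have AM: "A \<subseteq> space M" using A by (rule sets.sets_into_space)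
  have "(\<lambda>w. if w \<in> strip then f (cyc w) else 0) \<in> borel_measurable W"
    using f by (intro predictable_extend_measurable) (auto simp: selections_def \<L>_space_def)
  then show "(\<lambda>w. indicator (A \<times> slab s) w *\<^sub>R f (cyc w)) \<in> borel_measurable W"
    using sets_cylinder[OF A, of s]
    by (subst indicator_strip(2)[OF s AM]) (intro borel_measurable_scaleR borel_measurable_indicator)
  have "(\<integral>\<^sup>+w. ennreal (norm (indicator (A \<times> slab s) w *\<^sub>R f (cyc w))) \<partial>W) \<le> mean_norm F T"
    unfolding mean_norm_def
  proof (rule nn_integral_mono_AE, rule eventually_mono[OF selection_AE[OF f]])
    fix w assume w: "w \<in> strip \<longrightarrow> f (cyc w) \<in> F (cyc w)"
    show "ennreal (norm (indicator (A \<times> slab s) w *\<^sub>R f (cyc w))) \<le> indicator (space M \<times> slab T) w * norm_K (F (cyc w))"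
    proof (cases "w \<in> A \<times> slab s")
      case True
      then have "w \<in> strip" "w \<in> space M \<times> slab T" using AM s by auto
      then show ?thesis using w True norm_le_norm_K[of "f (cyc w)" "F (cyc w)"] by simp
    qed simp
  qed
  then show "(\<integral>\<^sup>+w. ennreal (norm (indicator (A \<times> slab s) w *\<^sub>R f (cyc w))) \<partial>W) < \<infinity>"
    using mean_norm_finite[OF F] by (rule le_less_trans)
qed

lemma integral_on_no_jump:
  fixes F :: "real \<times> 'z \<times> 'w \<Rightarrow> 'x::{banach, second_countable_topology} set"
  assumes F: "F \<in> \<M>_space M \<F> \<nu> T" and f: "f \<in> selections M \<F> \<nu> T F" and s: "0 \<le> s" "s \<le> T"
  shows "integrable M (\<lambda>\<omega>. indicator (no_jump s) \<omega> *\<^sub>R compensated_integral \<nu> p f s \<omega>)"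
    and "(\<integral>\<omega>. indicator (no_jump s) \<omega> *\<^sub>R compensated_integral \<nu> p f s \<omega> \<partial>M)
      = - (\<integral>w. indicator (no_jump s \<times> slab s) w *\<^sub>R f (cyc w) \<partial>W)"
proof -
  let ?h = "\<lambda>w. indicator (no_jump s \<times> slab s) w *\<^sub>R f (cyc w)"
  have eq: "(\<lambda>\<omega>. indicator (no_jump s) \<omega> *\<^sub>R compensated_integral \<nu> p f s \<omega>)
      = (\<lambda>\<omega>. - (\<integral>y. ?h (\<omega>, y) \<partial>(lborel \<Otimes>\<^sub>M \<nu>)))"
    by (auto simp: fun_eq_iff compensated_integral_no_jump indicator_def)
  note int = selection_integrable[OF F f events_no_jump[OF s(1)] s(2)]
  show "integrable M (\<lambda>\<omega>. indicator (no_jump s) \<omega> *\<^sub>R compensated_integral \<nu> p f s \<omega>)"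
    unfolding eq using W.integrable_fst'[OF int] by (rule integrable_minus)
  show "(\<integral>\<omega>. indicator (no_jump s) \<omega> *\<^sub>R compensated_integral \<nu> p f s \<omega> \<partial>M) = - integral\<^sup>L W ?h"
    unfolding eq using W.integral_fst'[OF int] by simp
qed

text \<open>The bound does not depend on the number of pieces of \<open>\<eta>\<close>: each path belongs to a single piece, and there
  \<open>\<eta>\<close> is minus the Lebesgue integral of one selection, whose norm is at most \<open>\<parallel>F\<parallel>\<close>.\<close>

lemma hull_norm_on_no_jump:
  fixes F :: "real \<times> 'z \<times> 'w \<Rightarrow> 'x::{banach, second_countable_topology} set"
  assumes F: "F \<in> \<M>_space M \<F> \<nu> T" and s: "0 \<le> s" "s \<le> T"
    and \<eta>: "\<eta> \<in> decomposable_hull (\<F> s) {compensated_integral \<nu> p f s | f. f \<in> selections M \<F> \<nu> T F}"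
  shows "(\<integral>\<^sup>+\<omega>. indicator (no_jump s) \<omega> * ennreal (norm (\<eta> \<omega>)) \<partial>M) \<le> mean_norm F s"
proof -
  obtain m A g where \<eta>_eq: "\<eta> = (\<lambda>\<omega>. \<Sum>i<m. indicator (A i) \<omega> *\<^sub>R g i \<omega>)"
    and A: "disjoint_family_on A {..<m::nat}" "(\<Union>i<m. A i) = space (\<F> s)"
    and "g ` {..<m} \<subseteq> {compensated_integral \<nu> p f s | f. f \<in> selections M \<F> \<nu> T F}"
    using \<eta> by (auto simp: decomposable_hull_def)
  then have "\<forall>i\<in>{..<m}. \<exists>f. f \<in> selections M \<F> \<nu> T F \<and> g i = compensated_integral \<nu> p f s" by auto
  then obtain f where f: "\<And>i. i < m \<Longrightarrow> f i \<in> selections M \<F> \<nu> T F"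
    "\<And>i. i < m \<Longrightarrow> g i = compensated_integral \<nu> p (f i) s"
    by (auto dest!: bchoice)
  have "AE \<omega> in M. \<forall>i\<in>{..<m}. AE y in lborel \<Otimes>\<^sub>M \<nu>. (\<omega>, y) \<in> strip \<longrightarrow> f i (cyc (\<omega>, y)) \<in> F (cyc (\<omega>, y))"
    using W.AE_pair[OF selection_AE[OF f(1)]] by (intro AE_finite_allI) auto
  then have "AE \<omega> in M. indicator (no_jump s) \<omega> * ennreal (norm (\<eta> \<omega>))
     \<le> (\<integral>\<^sup>+y. indicator (space M \<times> slab s) (\<omega>, y) * norm_K (F (cyc (\<omega>, y))) \<partial>(lborel \<Otimes>\<^sub>M \<nu>))"
  proof (rule eventually_mono)
    fix \<omega>
    assume sel: "\<forall>i\<in>{..<m}. AE y in lborel \<Otimes>\<^sub>M \<nu>. (\<omega>, y) \<in> strip \<longrightarrow> f i (cyc (\<omega>, y)) \<in> F (cyc (\<omega>, y))"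
    show "indicator (no_jump s) \<omega> * ennreal (norm (\<eta> \<omega>))
     \<le> (\<integral>\<^sup>+y. indicator (space M \<times> slab s) (\<omega>, y) * norm_K (F (cyc (\<omega>, y))) \<partial>(lborel \<Otimes>\<^sub>M \<nu>))"
    proof (cases "\<omega> \<in> no_jump s")
      case True
      then have w: "\<omega> \<in> space M" by (simp add: no_jump_def)
      then obtain i where i: "i < m" "\<omega> \<in> A i" using A(2) space_F[OF s(1)] by auto
      have "indicator (A j) \<omega> = (if j = i then 1 else 0 :: real)" if "j < m" for j
        using A(1) i that by (auto simp: disjoint_family_on_def indicator_def)
      then have "\<eta> \<omega> = (\<Sum>j<m. (if j = i then 1 else 0 :: real) *\<^sub>R g j \<omega>)"
        unfolding \<eta>_eq by (intro sum.cong) auto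
      also have "\<dots> = (\<Sum>j<m. if j = i then g j \<omega> else 0)"
        by (intro sum.cong) auto
      also have "\<dots> = g i \<omega>" using i by simp
      finally have "\<eta> \<omega> = - (LINT y|(lborel \<Otimes>\<^sub>M \<nu>). indicator (slab s) y *\<^sub>R f i (cyc (\<omega>, y)))"
        using f(2)[OF i(1)] compensated_integral_no_jump[OF True] by simp
      then have "ennreal (norm (\<eta> \<omega>)) \<le> (\<integral>\<^sup>+y. ennreal (norm (indicator (slab s) y *\<^sub>R f i (cyc (\<omega>, y)))) \<partial>(lborel \<Otimes>\<^sub>M \<nu>))"
        by (simp only: norm_minus_cancel norm_integral_le_nn_integral)
      also have "\<dots> \<le> (\<integral>\<^sup>+y. indicator (space M \<times> slab s) (\<omega>, y) * norm_K (F (cyc (\<omega>, y))) \<partial>(lborel \<Otimes>\<^sub>M \<nu>))"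
      proof (rule nn_integral_mono_AE, rule eventually_mono)
        show "AE y in lborel \<Otimes>\<^sub>M \<nu>. (\<omega>, y) \<in> strip \<longrightarrow> f i (cyc (\<omega>, y)) \<in> F (cyc (\<omega>, y))"
          using sel i by auto
        fix y assume "(\<omega>, y) \<in> strip \<longrightarrow> f i (cyc (\<omega>, y)) \<in> F (cyc (\<omega>, y))"
        then show "ennreal (norm (indicator (slab s) y *\<^sub>R f i (cyc (\<omega>, y))))
           \<le> indicator (space M \<times> slab s) (\<omega>, y) * norm_K (F (cyc (\<omega>, y)))"
          using w s norm_le_norm_K by (cases y) (auto simp: indicator_def)
      qed
      finally show ?thesis using True by simp
    qed simp
  qed
  then have "(\<integral>\<^sup>+\<omega>. indicator (no_jump s) \<omega> * ennreal (norm (\<eta> \<omega>)) \<partial>M)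
     \<le> (\<integral>\<^sup>+\<omega>. \<integral>\<^sup>+y. indicator (space M \<times> slab s) (\<omega>, y) * norm_K (F (cyc (\<omega>, y))) \<partial>(lborel \<Otimes>\<^sub>M \<nu>) \<partial>M)"
    by (rule nn_integral_mono_AE)
  also have "\<dots> = mean_norm F s"
    unfolding mean_norm_def by (rule tz.P.nn_integral_fst[OF measurable_mean_norm[OF F s(2)]])
  finally show ?thesis .
qed

end

section \<open>Consequences of the martingale property\<close>

lemma L1_closure_superset: "g \<in> \<Gamma> \<Longrightarrow> g \<in> L1 M G \<Longrightarrow> g \<in> L1_closure M G \<Gamma>"
  unfolding L1_closure_def by (auto intro!: bexI[of _ g])

context poisson_setting
begin

text \<open>Over the \<open>\<F>\<^sub>s\<close>-measurable set \<open>no_jump s\<close>, the integral of \<open>\<xi>\<close> is that of its conditional expectation, a selection of \<open>I\<^sub>s\<close>,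
  and this is small by \<open>hull_norm_on_no_jump\<close>. Estimating only on \<open>no_jump s\<close> loses nothing in the limit \<open>s \<rightarrow> 0\<close>, by
  dominated convergence with the dominating function \<open>\<parallel>\<xi>\<parallel>\<close>.\<close>

lemma martingale_selection_mean_zero:
  fixes F :: "real \<times> 'z \<times> 'w \<Rightarrow> 'x::{banach, second_countable_topology} set"
  assumes F: "F \<in> \<M>_space M \<F> \<nu> T"
    and I: "\<And>t. t \<in> {0<..T} \<Longrightarrow> is_set_integral M \<F> \<nu> p T F t (I t)"
    and mart: "set_valued_martingale M \<F> {0<..T} I"
    and \<xi>: "\<xi> \<in> S1 M (\<F> T) (I T)"
  shows "integral\<^sup>L M \<xi> = 0"
proof -
  have T: "T \<in> {0<..T}" "0 \<le> T" using T_pos by auto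
  have int_\<xi>: "integrable M \<xi>" using \<xi> by (simp add: S1_def L1_def)
  have \<xi>M: "\<xi> \<in> S1 M M (I T)"
    using \<xi> measurable_F_M[OF T(2)] by (auto simp: S1_def L1_def)
  have bound: "ennreal (norm (\<integral>\<omega>. indicator (no_jump s) \<omega> *\<^sub>R \<xi> \<omega> \<partial>M)) \<le> mean_norm F s"
    if s: "s \<in> {0<..T}" for s
  proof (rule ennreal_le_epsilon)
    fix e :: real assume e: "0 < e"
    obtain H where H: "has_set_cond_exp M (\<F> s) (I T) H" "S1 M (\<F> s) H = S1 M (\<F> s) (I s)"
      using mart s T(1) unfolding set_valued_martingale_def by force
    have sub: "subalgebra M (\<F> s)" using s by (intro subalg) auto
    obtain h where h: "has_cond_exp M (\<F> s) \<xi> h"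
      using cond_exp_exists[OF finite_measure_axioms sub int_\<xi>] by blast
    then have hL1: "h \<in> L1 M (\<F> s)" and int_h: "integrable M h"
      by (auto simp: has_cond_exp_def L1_def)
    have "h \<in> L1_closure M (\<F> s) {h. \<exists>f\<in>S1 M M (I T). has_cond_exp M (\<F> s) f h}"
      using h \<xi>M by (intro L1_closure_superset hL1) auto
    also have "\<dots> = S1 M (\<F> s) (I s)"
      using H by (simp add: has_set_cond_exp_def)
    also have "\<dots> = L1_closure M M (decomposable_hull (\<F> s)
        {compensated_integral \<nu> p f s | f. f \<in> selections M \<F> \<nu> T F})"
      using I[OF s] by (simp add: is_set_integral_def)
    finally obtain \<eta> where \<eta>: "\<eta> \<in> decomposable_hull (\<F> s)
        {compensated_integral \<nu> p f s | f. f \<in> selections M \<F> \<nu> T F}"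
      "integrable M \<eta>" "(\<integral>\<omega>. norm (\<eta> \<omega> - h \<omega>) \<partial>M) < e"
      using e by (auto simp: L1_closure_def L1_def)
    have B: "no_jump s \<in> events" "no_jump s \<in> sets (\<F> s)"
      using s by (auto intro!: events_no_jump sets_no_jump)
    have "(\<integral>\<omega>. indicator (no_jump s) \<omega> *\<^sub>R \<xi> \<omega> \<partial>M) = (\<integral>\<omega>. indicator (no_jump s) \<omega> *\<^sub>R h \<omega> \<partial>M)"
      using h B(2) by (simp add: has_cond_exp_def set_lebesgue_integral_def)
    also have "ennreal (norm \<dots>) \<le> (\<integral>\<^sup>+\<omega>. ennreal (norm (indicator (no_jump s) \<omega> *\<^sub>R h \<omega>)) \<partial>M)"
      by (rule norm_integral_le_nn_integral)
    also have "\<dots> \<le> (\<integral>\<^sup>+\<omega>. indicator (no_jump s) \<omega> * ennreal (norm (\<eta> \<omega>)) + ennreal (norm (\<eta> \<omega> - h \<omega>)) \<partial>M)"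
    proof (rule nn_integral_mono)
      fix \<omega>
      have "norm (h \<omega>) \<le> norm (\<eta> \<omega>) + norm (\<eta> \<omega> - h \<omega>)"
        using norm_triangle_sub[of "h \<omega>" "\<eta> \<omega>"] by (simp add: norm_minus_commute)
      then show "ennreal (norm (indicator (no_jump s) \<omega> *\<^sub>R h \<omega>))
          \<le> indicator (no_jump s) \<omega> * ennreal (norm (\<eta> \<omega>)) + ennreal (norm (\<eta> \<omega> - h \<omega>))"
        by (auto simp: indicator_def ennreal_plus[symmetric] simp del: ennreal_plus)
    qed
    also have "\<dots> = (\<integral>\<^sup>+\<omega>. indicator (no_jump s) \<omega> * ennreal (norm (\<eta> \<omega>)) \<partial>M)
        + (\<integral>\<^sup>+\<omega>. ennreal (norm (\<eta> \<omega> - h \<omega>)) \<partial>M)"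
      using \<eta>(2) int_h B(1) by (intro nn_integral_add) auto
    also have "(\<integral>\<^sup>+\<omega>. ennreal (norm (\<eta> \<omega> - h \<omega>)) \<partial>M) = ennreal (\<integral>\<omega>. norm (\<eta> \<omega> - h \<omega>) \<partial>M)"
      using \<eta>(2) int_h by (intro nn_integral_eq_integral) auto
    also have "\<dots> \<le> ennreal e" using \<eta>(3) by (intro ennreal_leI) auto
    also have "(\<integral>\<^sup>+\<omega>. indicator (no_jump s) \<omega> * ennreal (norm (\<eta> \<omega>)) \<partial>M) \<le> mean_norm F s"
      using s by (intro hull_norm_on_no_jump[OF F _ _ \<eta>(1)]) auto
    finally show "ennreal (norm (\<integral>\<omega>. indicator (no_jump s) \<omega> *\<^sub>R \<xi> \<omega> \<partial>M)) \<le> mean_norm F s + ennreal e"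
      by (simp add: add_mono)
  qed
  have "(\<lambda>n. \<integral>\<omega>. indicator (no_jump (small_time n)) \<omega> *\<^sub>R \<xi> \<omega> \<partial>M) \<longlonglongrightarrow> integral\<^sup>L M \<xi>"
  proof (rule integral_dominated_convergence[where w="\<lambda>\<omega>. norm (\<xi> \<omega>)"])
    show "AE \<omega> in M. (\<lambda>n. indicator (no_jump (small_time n)) \<omega> *\<^sub>R \<xi> \<omega>) \<longlonglongrightarrow> \<xi> \<omega>"
      using AE_eventually_no_jump
      by (rule eventually_mono) (auto intro!: tendsto_eventually elim!: eventually_mono)
    show "(\<lambda>\<omega>. indicator (no_jump (small_time n)) \<omega> *\<^sub>R \<xi> \<omega>) \<in> borel_measurable M" for n
      using int_\<xi> events_no_jump[of "small_time n"] small_time(1)[of n] by simp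
  qed (use int_\<xi> in \<open>auto simp: indicator_def\<close>)
  then have "(\<lambda>n. ennreal (norm (\<integral>\<omega>. indicator (no_jump (small_time n)) \<omega> *\<^sub>R \<xi> \<omega> \<partial>M)))
      \<longlonglongrightarrow> ennreal (norm (integral\<^sup>L M \<xi>))"
    by (intro tendsto_ennrealI tendsto_norm)
  then have "ennreal (norm (integral\<^sup>L M \<xi>)) \<le> 0"
    by (rule LIMSEQ_le[OF _ mean_norm_tendsto[OF F]]) (use bound small_time in auto)
  then show ?thesis by simp
qed

lemma predictable_selection:
  fixes F :: "real \<times> 'z \<times> 'w \<Rightarrow> 'x::{banach, second_countable_topology} set"
  assumes F: "F \<in> \<M>_space M \<F> \<nu> T"
    and f: "f \<in> borel_measurable (predictable_sigma TYPE('x) M \<F> T)"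
    and sel: "\<And>x. x \<in> {0..T} \<times> UNIV \<times> space M \<Longrightarrow> f x \<in> F x"
  shows "f \<in> selections M \<F> \<nu> T F"
proof -
  have "(\<integral>\<^sup>+\<omega>. (\<integral>\<^sup>+t\<in>{0..T}. (\<integral>\<^sup>+z. ennreal ((norm (f (t, z, \<omega>)))\<^sup>2) \<partial>\<nu>) \<partial>lborel) \<partial>M)
     \<le> (\<integral>\<^sup>+\<omega>. (\<integral>\<^sup>+t\<in>{0..T}. (\<integral>\<^sup>+z. (norm_K (F (t, z, \<omega>)))\<^sup>2 \<partial>\<nu>) \<partial>lborel) \<partial>M)"
  proof (intro nn_integral_mono)
    fix \<omega> t assume w: "\<omega> \<in> space M"
    show "(\<integral>\<^sup>+z. ennreal ((norm (f (t, z, \<omega>)))\<^sup>2) \<partial>\<nu>) * indicator {0..T} t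
        \<le> (\<integral>\<^sup>+z. (norm_K (F (t, z, \<omega>)))\<^sup>2 \<partial>\<nu>) * indicator {0..T} t"
    proof (cases "t \<in> {0..T}")
      case True
      have "ennreal ((norm (f (t, z, \<omega>)))\<^sup>2) \<le> (norm_K (F (t, z, \<omega>)))\<^sup>2" for z
        using norm_le_norm_K[OF sel[of "(t, z, \<omega>)"]] True w
        by (simp add: ennreal_power[symmetric] power_mono)
      then show ?thesis by (intro mult_right_mono nn_integral_mono) auto
    qed simp
  qed
  also have "\<dots> < \<infinity>" using F by (simp add: \<M>_space_def)
  finally have "f \<in> \<L>_space M \<F> \<nu> T" using f by (simp add: \<L>_space_def)
  moreover have "AE x in restrict_space lborel {0..T} \<Otimes>\<^sub>M (\<nu> \<Otimes>\<^sub>M M). f x \<in> F x"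
    by (rule AE_I2, rule sel) (auto simp: space_pair_measure space_restrict_space)
  ultimately show ?thesis by (simp add: selections_def)
qed

text \<open>On \<open>no_jump T\<close>, integrals of selections are obtained by Fubini's theorem from the Lebesgue integral, and centredness
  of all patched selections leaves one possible value for them. Switching between \<open>f\<close> and \<open>g\<close> along
  the predictable sets \<open>{f - g \<in> A}\<close> then localises the equality of the integrals.\<close>

lemma martingale_unique_selection:
  fixes F :: "real \<times> 'z \<times> 'w \<Rightarrow> 'x::{banach, second_countable_topology} set"
  assumes F: "F \<in> \<M>_space M \<F> \<nu> T"
    and I: "\<And>t. t \<in> {0<..T} \<Longrightarrow> is_set_integral M \<F> \<nu> p T F t (I t)"
    and mart: "set_valued_martingale M \<F> {0<..T} I"
    and f: "f \<in> borel_measurable (predictable_sigma TYPE('x) M \<F> T)"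
      "\<And>x. x \<in> {0..T} \<times> UNIV \<times> space M \<Longrightarrow> f x \<in> F x"
    and g: "g \<in> borel_measurable (predictable_sigma TYPE('x) M \<F> T)"
      "\<And>x. x \<in> {0..T} \<times> UNIV \<times> space M \<Longrightarrow> g x \<in> F x"
  shows "AE w in W. w \<in> no_jump T \<times> slab T \<longrightarrow> f (cyc w) = g (cyc w)"
proof -
  let ?P = "predictable_sigma TYPE('x) M \<F> T :: (real \<times> 'z \<times> 'w) measure"
  let ?hull = "decomposable_hull (\<F> T) {compensated_integral \<nu> p f T | f. f \<in> selections M \<F> \<nu> T F}"
  have T: "T \<in> {0<..T}" "0 \<le> T" using T_pos by auto
  define B where "B = no_jump T"
  have B: "B \<in> events" "B \<in> sets (\<F> T)"
    using T by (auto simp: B_def intro!: events_no_jump sets_no_jump)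
  have S1_IT: "S1 M (\<F> T) (I T) = L1_closure M M ?hull"
    and meas_IT: "set_measurable (\<F> T) (I T)"
    using I[OF T(1)] by (auto simp: is_set_integral_def)
  \<comment> \<open>An integrable filler off \<open>no_jump T\<close>: the values of \<open>I T\<close> are integrably bounded, hence \<open>S1\<close> is not empty,
    and neither is the set of integrable members of the hull, whose closure it is.\<close>
  obtain \<eta> where \<eta>: "\<eta> \<in> ?hull" "integrable M \<eta>"
  proof -
    obtain \<zeta> where \<zeta>: "\<zeta> \<in> borel_measurable (\<F> T)" "\<And>\<omega>. \<omega> \<in> space (\<F> T) \<Longrightarrow> \<zeta> \<omega> \<in> I T \<omega>"
      by (rule measurable_selection[OF meas_IT]) blast
    have "integrable M \<zeta>"
    proof (rule integrableI_bounded)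
      show "\<zeta> \<in> borel_measurable M" using \<zeta>(1) T(2) by (rule measurable_F_M[rotated])
      have "(\<integral>\<^sup>+\<omega>. ennreal (norm (\<zeta> \<omega>)) \<partial>M) \<le> (\<integral>\<^sup>+\<omega>. norm_K (I T \<omega>) \<partial>M)"
        using \<zeta>(2) space_F[OF T(2)] by (intro nn_integral_mono norm_le_norm_K) auto
      also have "\<dots> < \<infinity>"
        using mart T(1) by (auto simp: set_valued_martingale_def integrably_bounded_def)
      finally show "(\<integral>\<^sup>+\<omega>. ennreal (norm (\<zeta> \<omega>)) \<partial>M) < \<infinity>" .
    qed
    then have "\<zeta> \<in> S1 M (\<F> T) (I T)"
      using \<zeta> space_F[OF T(2)] by (auto simp: S1_def L1_def)
    then have "\<zeta> \<in> L1_closure M M ?hull" by (simp only: S1_IT)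
    then show thesis using that by (auto simp: L1_closure_def L1_def dest!: spec[of _ 1])
  qed
  \<comment> \<open>the right-hand side does not involve \<open>u\<close>\<close>
  have const: "(\<integral>w. indicator (B \<times> slab T) w *\<^sub>R u (cyc w) \<partial>W) = (\<integral>\<omega>. indicator (space M - B) \<omega> *\<^sub>R \<eta> \<omega> \<partial>M)"
    if u: "u \<in> selections M \<F> \<nu> T F" for u
  proof -
    define \<xi> where "\<xi> \<omega> = indicator B \<omega> *\<^sub>R compensated_integral \<nu> p u T \<omega>
      + indicator (space M - B) \<omega> *\<^sub>R \<eta> \<omega>" for \<omega>
    have "\<xi> \<in> ?hull"
      unfolding \<xi>_def space_F[OF T(2), symmetric] using u
      by (intro decomposable_hull_paste B(2) \<eta>(1)) auto
    have i1: "integrable M (\<lambda>\<omega>. indicator B \<omega> *\<^sub>R compensated_integral \<nu> p u T \<omega>)"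
      unfolding B_def by (rule integral_on_no_jump(1)[OF F u T(2) order_refl])
    have i2: "integrable M (\<lambda>\<omega>. indicator (space M - B) \<omega> *\<^sub>R \<eta> \<omega>)"
      using B(1) \<eta>(2) by (intro integrable_mult_indicator) auto
    have "\<xi> \<in> L1 M M" unfolding L1_def \<xi>_def using i1 i2 by auto
    with \<open>\<xi> \<in> ?hull\<close> have \<xi>_S1: "\<xi> \<in> S1 M (\<F> T) (I T)"
      unfolding S1_IT by (rule L1_closure_superset)
    have "integral\<^sup>L M \<xi> = 0"
      by (rule martingale_selection_mean_zero[OF F _ mart \<xi>_S1]) (rule I)
    moreover have "integral\<^sup>L M \<xi> = - (\<integral>w. indicator (B \<times> slab T) w *\<^sub>R u (cyc w) \<partial>W)
        + (\<integral>\<omega>. indicator (space M - B) \<omega> *\<^sub>R \<eta> \<omega> \<partial>M)"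
      unfolding \<xi>_def using i1 i2 integral_on_no_jump(2)[OF F u T(2) order_refl]
      by (simp add: B_def)
    ultimately show ?thesis by (simp add: add_eq_0_iff)
  qed
  define h where "h w = indicator (B \<times> slab T) w *\<^sub>R (f (cyc w) - g (cyc w))" for w
  note fsel = predictable_selection[OF F f] and gsel = predictable_selection[OF F g]
  have int: "integrable W (\<lambda>w. indicator (B \<times> slab T) w *\<^sub>R u (cyc w))" if "u \<in> selections M \<F> \<nu> T F" for u
    by (rule selection_integrable[OF F that B(1) order_refl])
  have int_h: "integrable W h"
    unfolding h_def scaleR_diff_right using int[OF fsel] int[OF gsel] by simp
  have "AE w in W. h w = 0"
  proof (rule AE_zero_if_integrals_zero[OF int_h])
    fix A :: "'x set" assume A: "A \<in> sets borel"
    \<comment> \<open>switch from \<open>g\<close> to \<open>f\<close> exactly where \<open>f - g\<close> takes values in \<open>A\<close>\<close>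
    define D where "D = {x \<in> space ?P. f x - g x \<in> A}"
    define u where "u x = (if x \<in> D then f x else g x)" for x
    have "D \<in> sets ?P"
      using measurable_sets[OF borel_measurable_diff[OF f(1) g(1)] A]
      by (simp add: D_def vimage_def Int_def conj_commute)
    then have "u \<in> borel_measurable ?P"
      unfolding u_def using f(1) g(1) by (intro measurable_If_set) auto
    then have usel: "u \<in> selections M \<F> \<nu> T F"
      using f(2) g(2) by (intro predictable_selection[OF F]) (auto simp: u_def)
    have "set_lebesgue_integral W (h -` A \<inter> space W) h
        = (\<integral>w. indicator (B \<times> slab T) w *\<^sub>R u (cyc w) - indicator (B \<times> slab T) w *\<^sub>R g (cyc w) \<partial>W)"
      unfolding set_lebesgue_integral_def
    proof (rule Bochner_Integration.integral_cong[OF refl])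
      fix w assume w: "w \<in> space W"
      show "indicator (h -` A \<inter> space W) w *\<^sub>R h w
        = indicator (B \<times> slab T) w *\<^sub>R u (cyc w) - indicator (B \<times> slab T) w *\<^sub>R g (cyc w)"
      proof (cases "w \<in> B \<times> slab T")
        case True
        then have "cyc w \<in> space ?P"
          using sets.sets_into_space[OF B(1)] by (auto simp: space_predictable)
        then show ?thesis
          using True w by (auto simp: h_def u_def D_def indicator_def)
      qed (simp add: h_def)
    qed
    also have "\<dots> = 0"
      using int[OF usel] int[OF gsel] const[OF usel] const[OF gsel]
      by (simp add: Bochner_Integration.integral_diff)
    finally show "set_lebesgue_integral W (h -` A \<inter> space W) h = 0" .
  qed
  then show ?thesis
    by (rule eventually_mono) (auto simp: h_def B_def)
qed

end

theorem theorem3p5: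
  fixes M :: "'w measure" and \<F> :: "real \<Rightarrow> 'w measure"
    and \<nu> :: "'z::{banach, second_countable_topology} measure"
    and p :: "'w \<Rightarrow> real \<rightharpoonup> 'z"
    and T :: real
    and F :: "real \<times> 'z \<times> 'w \<Rightarrow> 'x::{banach, second_countable_topology} set"
    and I :: "real \<Rightarrow> 'w \<Rightarrow> 'x set"
  assumes "usual_filtered_prob_space M \<F>"
    and "sets \<nu> = sets borel" and "finite_measure \<nu>" and "emeasure \<nu> UNIV > 0"
    and "T > 0"
    and "stationary_poisson_point_process M \<F> \<nu> p"
    and "M_type_2 TYPE('x)"
    and "F \<in> \<M>_space M \<F> \<nu> T"
    and "nondegenerate_convex_process M \<nu> T F"
    and "\<And>t. t \<in> {0<..T} \<Longrightarrow> is_set_integral M \<F> \<nu> p T F t (I t)"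
  shows "\<not> set_valued_martingale M \<F> {0<..T} I"
proof
  assume mart: "set_valued_martingale M \<F> {0<..T} I"
  interpret poisson_setting M \<F> \<nu> p T
    by (intro poisson_setting.intro poisson_setting_axioms.intro) (fact assms)+
  interpret zw: pair_sigma_finite \<nu> M ..
  let ?P = "predictable_sigma TYPE('x) M \<F> T :: (real \<times> 'z \<times> 'w) measure"
  let ?B = "no_jump T"
  have F_meas: "set_measurable ?P F" using assms(8) by (simp add: \<M>_space_def)
  obtain f :: "nat \<Rightarrow> real \<times> 'z \<times> 'w \<Rightarrow> 'x" where f: "\<And>n. f n \<in> borel_measurable ?P"
      "\<And>n x. x \<in> {0..T} \<times> UNIV \<times> space M \<Longrightarrow> f n x \<in> F x"
      "\<And>x. x \<in> {0..T} \<times> UNIV \<times> space M \<Longrightarrow> F x \<subseteq> closure (range (\<lambda>n. f n x))"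
    by (rule Castaing_representation[OF F_meas, unfolded space_predictable]) blast
  \<comment> \<open>where all members of the Castaing representation agree, \<open>F\<close> is a singleton\<close>
  let ?agree = "\<lambda>w. w \<in> ?B \<times> slab T \<longrightarrow> (\<forall>n. f n (cyc w) = f 0 (cyc w))"
  have "AE w in W. \<forall>n. w \<in> ?B \<times> slab T \<longrightarrow> f n (cyc w) = f 0 (cyc w)"
    unfolding AE_all_countable
    by (intro allI martingale_unique_selection[OF assms(8) _ mart] f assms(10))
  then have agree: "AE w in W. ?agree w" by (rule eventually_mono) blast
  \<comment> \<open>Non-degeneracy is known for each \<open>t\<close> separately, so that \<open>t\<close> has to become the outer variable; exchanging
    the quantifiers requires a measurable set.\<close>
  have agree_sets: "{w \<in> space W. ?agree w} \<in> sets W"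
  proof -
    let ?f = "\<lambda>n w. if w \<in> strip then f n (cyc w) else 0"
    have [measurable]: "?f n \<in> borel_measurable W" for n
      by (rule predictable_extend_measurable[OF f(1)]) simp
    have "{w \<in> space W. ?f n w = ?f 0 w} \<in> sets W" for n by measurable
    then have "{w \<in> space W. \<forall>n. ?f n w = ?f 0 w} \<in> sets W" by (rule sets.sets_Collect_countable_All)
    moreover have "?B \<times> slab T \<in> sets W"
      using T_pos by (intro sets_cylinder events_no_jump) simp
    ultimately have "(space W - ?B \<times> slab T) \<union> {w \<in> space W. \<forall>n. ?f n w = ?f 0 w} \<in> sets W"
      by (intro sets.Un sets.compl_sets)
    also have "(space W - ?B \<times> slab T) \<union> {w \<in> space W. \<forall>n. ?f n w = ?f 0 w}
        = {w \<in> space W. ?agree w}"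
      by (auto simp: no_jump_def split: if_splits)
    finally show ?thesis .
  qed
  have "AE y in lborel \<Otimes>\<^sub>M \<nu>. AE \<omega> in M. ?agree (\<omega>, y)"
    using W.AE_pair[OF agree] W.AE_commute[of "\<lambda>\<omega> y. ?agree (\<omega>, y)"] agree_sets by simp
  then have ae: "AE t in lborel. AE z in \<nu>. AE \<omega> in M. ?agree (\<omega>, t, z)"
    by (rule tz.AE_pair)
  have "AE t in lborel. t \<notin> {0<..T}"
  proof (rule eventually_mono[OF ae], rule notI)
    fix t :: real assume t: "AE z in \<nu>. AE \<omega> in M. ?agree (\<omega>, t, z)" and tT: "t \<in> {0<..T}"
    have "AE x in \<nu> \<Otimes>\<^sub>M M. infinite (F (t, fst x, snd x))"
      using assms(9) tT unfolding nondegenerate_convex_process_def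
      by (auto simp: case_prod_beta' elim!: eventually_mono)
    then have "AE z in \<nu>. AE \<omega> in M. infinite (F (t, z, \<omega>))"
      using zw.AE_pair by fastforce
    with t have "AE z in \<nu>. False"
    proof (eventually_elim)
      fix z
      assume "AE \<omega> in M. ?agree (\<omega>, t, z)" "AE \<omega> in M. infinite (F (t, z, \<omega>))"
      then have "AE \<omega> in M. \<omega> \<notin> ?B" using AE_space
      proof eventually_elim
        fix \<omega> assume ag: "?agree (\<omega>, t, z)" and inf: "infinite (F (t, z, \<omega>))" and w: "\<omega> \<in> space M"
        show "\<omega> \<notin> ?B"
        proof
          assume "\<omega> \<in> ?B"
          with ag tT have "range (\<lambda>n. f n (t, z, \<omega>)) = {f 0 (t, z, \<omega>)}" by auto
          with f(3)[of "(t, z, \<omega>)"] w tT have "F (t, z, \<omega>) \<subseteq> {f 0 (t, z, \<omega>)}" by simp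
          with inf show False using finite_subset by blast
        qed
      qed
      then have "prob ?B = 0"
        using T_pos by (subst prob_eq_0) (auto intro!: events_no_jump)
      then show False using prob_no_jump[OF T_pos] by simp
    qed
    then show False using assms(4) by (simp add: trivial_limit_def[symmetric] ae_filter_eq_bot_iff)
  qed
  then have "{0<..T} \<in> null_sets (lborel :: real measure)"
    by (simp add: Measure_Space.AE_iff_null_sets)
  then show False using T_pos by (simp add: null_sets_def)
qed

end
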